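(* Let $\Theta:\mathcal X\to(-\infty,\infty]$ be proper, lower semi-continuous and strongly convex with constant $c_0>0$ (in the sense given in the context). Let $\{\alpha_n\}$ be a decreasing sequence of positive numbers, let $\tau>1$, $0<\mu_0<4c_0(1-1/\tau)$ and $\mu_1>0$, and let $\xi_0\in\mathcal X$. For each $\delta>0$ let $y^\delta\in\mathcal Y$ satisfy $\|y^\delta-y\|\le\delta$, let $\{\xi_n^\delta\},\{x_n^\delta\}$ be generated by the noisy-data iteration described in the context with the step sizes $t_n^\delta$ given there, and let $n_\delta$ be the finite integer determined by the stopping rule described in the context. Then $$\lim_{\delta\to0}\|x_{n_\delta}^\delta-x^\dagger\|=0\qquad\text{and}\qquad\lim_{\delta\to0}D_{\xi_{n_\delta}^\delta}\Theta(x^\dagger,x_{n_\delta}^\delta)=0 .$$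
   Context: $\mathcal X,\mathcal Y$ are (real) Hilbert spaces, $A:\mathcal X\to\mathcal Y$ is a bounded linear operator with adjoint $A^*$, $I$ is the identity on $\mathcal Y$, and $y\in\mathcal Y$. For $\Theta:\mathcal X\to(-\infty,\infty]$ put $\mathscr D(\Theta)=\{x\in\mathcal X:\Theta(x)<\infty\}$; $\Theta$ is proper if $\mathscr D(\Theta)\neq\emptyset$. It is assumed throughout that the equation $Ax=y$ has a solution in $\mathscr D(\Theta)$. Strong convexity with constant $c_0>0$ means $$\Theta(s\bar x+(1-s)x)+c_0s(1-s)\|\bar x-x\|^2\le s\Theta(\bar x)+(1-s)\Theta(x)\quad\text{for all }0\le s\le1,\ \bar x,x\in\mathcal X.$$ The subdifferential is $\partial\Theta(x)=\{\xi\in\mathcal X:\Theta(\bar x)-\Theta(x)-\langle\xi,\bar x-x\rangle\ge0\ \forall\bar x\in\mathcal X\}$, and for $\xi\in\partial\Theta(x)$ the Bregman distance is $D_\xi\Theta(\bar x,x)=\Theta(\bar x)-\Theta(x)-\langle\xi,\bar x-x\rangle$. Noisy-data iteration: given $\xi_0\in\mathcal X$, set $x_0=\arg\min_{x\in\mathcal X}\{\Theta(x)-\langle\xi_0,x\rangle\}$, $\xi_0^\delta=\xi_0$, $x_0^\delta=x_0$, and for $n\ge0$ $$\xi_{n+1}^\delta=\xi_n^\delta-t_n^\delta A^*(\alpha_nI+AA^* )^{-1}(Ax_n^\delta-y^\delta),\qquad x_{n+1}^\delta=\arg\min_{x\in\mathcal X}\{\Theta(x)-\langle\xi_{n+1}^\delta,x\rangle\},$$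 $$t_n^\delta=\min\left\{\frac{\mu_0\langle(\alpha_nI+AA^* )^{-1}(Ax_n^\delta-y^\delta),Ax_n^\delta-y^\delta\rangle}{\|A^*(\alpha_nI+AA^* )^{-1}(Ax_n^\delta-y^\delta)\|^2},\ \mu_1\right\},$$ where the quotient is read as $+\infty$ (so $t_n^\delta=\mu_1$) if its denominator vanishes. One has $\xi_n^\delta\in\partial\Theta(x_n^\delta)$ for all $n$. Stopping rule: $n_\delta$ is the first integer $n\ge0$ such that $$\alpha_n\langle(\alpha_nI+AA^* )^{-1}(Ax_n^\delta-y^\delta),Ax_n^\delta-y^\delta\rangle\le\tau^2\delta^2 .$$ $x^\dagger$ denotes the unique solution of $Ax=y$ in $\mathscr D(\Theta)$ satisfying $D_{\xi_0}\Theta(x^\dagger,x_0)=\min\{D_{\xi_0}\Theta(x,x_0):Ax=y\}$. *)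

theory Defs
  imports "HOL-Analysis.Analysis"
begin

text \<open>
  Hilbert spaces are types of sort \<open>{real_inner, complete_space}\<close>; a function into
  \<open>(-\<infinity>, \<infinity>]\<close> is an \<^typ>\<open>ereal\<close>-valued function that avoids \<open>-\<infinity>\<close>.
\<close>

definition proper :: "('a \<Rightarrow> ereal) \<Rightarrow> bool" where
  "proper \<Theta> \<longleftrightarrow> (\<forall>x. \<Theta> x \<noteq> -\<infinity>) \<and> (\<exists>x. \<Theta> x < \<infinity>)"

definition lower_semicontinuous :: "('a::topological_space \<Rightarrow> ereal) \<Rightarrow> bool" where
  "lower_semicontinuous \<Theta> \<longleftrightarrow> (\<forall>x. \<Theta> x \<le> Liminf (at x) \<Theta>)"

text \<open>
  In \<^typ>\<open>ereal\<close> we have \<open>0 * \<infinity> = 0\<close>, so the cases \<open>s = 0\<close> and \<open>s = 1\<close> below hold trivially.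
  The constant multiplies \<open>s (1 - s)\<close> without a factor \<open>1/2\<close>.
\<close>

definition strongly_convex :: "real \<Rightarrow> ('a::real_inner \<Rightarrow> ereal) \<Rightarrow> bool" where
  "strongly_convex c \<Theta> \<longleftrightarrow>
     (\<forall>s x' x. 0 \<le> s \<and> s \<le> 1 \<longrightarrow>
        \<Theta> (s *\<^sub>R x' + (1 - s) *\<^sub>R x) + ereal (c * s * (1 - s) * (norm (x' - x))\<^sup>2)
          \<le> ereal s * \<Theta> x' + ereal (1 - s) * \<Theta> x)"

text \<open>
  The Bregman distance \<open>D\<^sub>\<xi> \<Theta> (x', x)\<close>; it is only meaningful when \<open>\<xi>\<close> is a subgradient of
  \<open>\<Theta>\<close> at \<open>x\<close>, in which case \<open>\<Theta> x\<close> is finite.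
\<close>

definition bregman :: "('a::real_inner \<Rightarrow> ereal) \<Rightarrow> 'a \<Rightarrow> 'a \<Rightarrow> 'a \<Rightarrow> ereal" where
  "bregman \<Theta> \<xi> x' x = \<Theta> x' - \<Theta> x - ereal (\<xi> \<bullet> (x' - x))"

definition tilted_min :: "('a::real_inner \<Rightarrow> ereal) \<Rightarrow> 'a \<Rightarrow> 'a" where
  "tilted_min \<Theta> \<xi> = arg_min (\<lambda>x. \<Theta> x - ereal (\<xi> \<bullet> x)) (\<lambda>_. True)"

text \<open>
  The operator \<open>(a I + A A\<^sup>*)\<^sup>-\<^sup>1\<close>; for bounded linear \<open>A\<close> between Hilbert spaces and
  \<open>a > 0\<close> the map being inverted is a bijection.
\<close>

definition reg_inv ::
    "('a::real_inner \<Rightarrow> 'b::real_inner) \<Rightarrow> real \<Rightarrow> 'b \<Rightarrow> 'b" where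
  "reg_inv A a = inv (\<lambda>z. a *\<^sub>R z + A (adjoint A z))"

text \<open>
  The step size for the residual \<open>r = A x - y\<^sup>\<delta>\<close> and \<open>a = \<alpha>\<^sub>n\<close>.  The quotient counts as
  \<open>+\<infinity>\<close> when its denominator vanishes, hence the case distinction.
\<close>

definition step_size ::
    "('a::real_inner \<Rightarrow> 'b::real_inner) \<Rightarrow> real \<Rightarrow> real \<Rightarrow> real \<Rightarrow> 'b \<Rightarrow> real" where
  "step_size A \<mu>0 \<mu>1 a r =
     (if norm (adjoint A (reg_inv A a r)) = 0 then \<mu>1
      else min (\<mu>0 * (reg_inv A a r \<bullet> r) / (norm (adjoint A (reg_inv A a r)))\<^sup>2) \<mu>1)"

text \<open>
  The dual iterates \<open>\<xi>\<^sub>n\<close> and primal iterates \<open>x\<^sub>n\<close> for data \<open>v\<close>.  Every primal iterate,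
  including \<open>x\<^sub>0\<close>, is the tilted minimizer of the dual one, so only the dual sequence is
  defined recursively.
\<close>

primrec xi_iter ::
    "('a::real_inner \<Rightarrow> ereal) \<Rightarrow> ('a \<Rightarrow> 'b::real_inner) \<Rightarrow> (nat \<Rightarrow> real) \<Rightarrow> real \<Rightarrow> real
      \<Rightarrow> 'a \<Rightarrow> 'b \<Rightarrow> nat \<Rightarrow> 'a" where
  "xi_iter \<Theta> A \<alpha> \<mu>0 \<mu>1 \<xi>0 v 0 = \<xi>0"
| "xi_iter \<Theta> A \<alpha> \<mu>0 \<mu>1 \<xi>0 v (Suc n) =
     (let \<xi> = xi_iter \<Theta> A \<alpha> \<mu>0 \<mu>1 \<xi>0 v n;
          r = A (tilted_min \<Theta> \<xi>) - v
      in \<xi> - step_size A \<mu>0 \<mu>1 (\<alpha> n) r *\<^sub>R adjoint A (reg_inv A (\<alpha> n) r))"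

definition x_iter ::
    "('a::real_inner \<Rightarrow> ereal) \<Rightarrow> ('a \<Rightarrow> 'b::real_inner) \<Rightarrow> (nat \<Rightarrow> real) \<Rightarrow> real \<Rightarrow> real
      \<Rightarrow> 'a \<Rightarrow> 'b \<Rightarrow> nat \<Rightarrow> 'a" where
  "x_iter \<Theta> A \<alpha> \<mu>0 \<mu>1 \<xi>0 v n = tilted_min \<Theta> (xi_iter \<Theta> A \<alpha> \<mu>0 \<mu>1 \<xi>0 v n)"

text \<open>
  The stopping index for data \<open>v\<close> with noise level \<open>\<delta>\<close>.  \<open>Least\<close> is unspecified if the
  criterion is never met.
\<close>

definition stop_index ::
    "('a::real_inner \<Rightarrow> ereal) \<Rightarrow> ('a \<Rightarrow> 'b::real_inner) \<Rightarrow> (nat \<Rightarrow> real) \<Rightarrow> real \<Rightarrow> real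
      \<Rightarrow> 'a \<Rightarrow> real \<Rightarrow> real \<Rightarrow> 'b \<Rightarrow> nat" where
  "stop_index \<Theta> A \<alpha> \<mu>0 \<mu>1 \<xi>0 \<tau> \<delta> v =
     (LEAST n. let r = A (x_iter \<Theta> A \<alpha> \<mu>0 \<mu>1 \<xi>0 v n) - v
               in \<alpha> n * (reg_inv A (\<alpha> n) r \<bullet> r) \<le> \<tau>\<^sup>2 * \<delta>\<^sup>2)"

text \<open>
  The solution \<open>x\<^sup>\<dagger>\<close> of \<open>A x = y\<close> closest to \<open>x\<^sub>0 = tilted_min \<Theta> \<xi>0\<close> in Bregman distance.
\<close>

definition min_solution ::
    "('a::real_inner \<Rightarrow> ereal) \<Rightarrow> ('a \<Rightarrow> 'b::real_inner) \<Rightarrow> 'a \<Rightarrow> 'b \<Rightarrow> 'a" where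
  "min_solution \<Theta> A \<xi>0 y =
     (THE x. A x = y \<and> \<Theta> x < \<infinity> \<and>
        (\<forall>x'. A x' = y \<longrightarrow>
           bregman \<Theta> \<xi>0 x (tilted_min \<Theta> \<xi>0) \<le> bregman \<Theta> \<xi>0 x' (tilted_min \<Theta> \<xi>0)))"

end

theory Submission imports Defs begin

text \<open>
  Why the theorem is true.  Write \<open>\<theta>\<close> for \<open>\<Theta>\<close> on its domain and \<open>p\<close> for \<open>x\<^sup>\<dagger>\<close>, a minimizer of
  \<open>\<theta> x - \<xi>\<^sub>0 \<bullet> x\<close> subject to \<open>A x = y\<close>.  The iteration only ever changes \<open>\<xi>\<close> by elements of the range
  of \<open>A\<^sup>*\<close>, so \<open>\<xi>\<^sub>n = \<xi>\<^sub>0 - A\<^sup>* w\<^sub>n\<close> for dual variables \<open>w\<^sub>n\<close> that start at \<open>0\<close> and move by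
  \<open>t\<^sub>n z\<^sub>n\<close> with \<open>z\<^sub>n = (\<alpha>\<^sub>n I + A A\<^sup>*)\<^sup>-\<^sup>1 (A x\<^sub>n - y\<^sup>\<delta>)\<close>.  The Bregman distance
  \<open>gap n = \<theta> p - \<theta> x\<^sub>n - \<xi>\<^sub>n \<bullet> (p - x\<^sub>n)\<close> is then the primal-dual gap at \<open>w\<^sub>n\<close>: a convex function
  of the dual variable with gradient \<open>y - A x\<^sub>n\<close>, and the method is a perturbed, preconditioned
  gradient descent for it.  The distance dominates \<open>c\<^sub>0 \<parallel>x\<^sub>n - p\<parallel>\<^sup>2\<close>, so it suffices to make it
  small at the stopping index.

  Three facts carry the proof.  First, there is no duality gap (\<open>zero_duality_gap\<close>): some dual
  variable \<open>w'\<close>, independent of the noise, has gap at most any prescribed \<open>e > 0\<close>.  It is found by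
  minimizing \<open>\<theta> x - \<xi>\<^sub>0 \<bullet> x + k \<parallel>A x - y\<parallel>\<^sup>2\<close> for large \<open>k\<close>.  Second, as long as the stopping rule
  has not fired, the noise is dominated by the residual and the gap decreases by a fixed multiple
  of \<open>q\<^sub>n = z\<^sub>n \<bullet> (A x\<^sub>n - y\<^sup>\<delta>)\<close> (\<open>gap_Suc\<close>).  Hence the rule does fire, the \<open>q\<^sub>n\<close> have a sum bounded
  independently of the noise, and \<open>w\<^sub>n\<close> has a bound depending only on \<open>n\<close>.  Third, convexity
  compares the gap at \<open>w\<^sub>n\<close> with the gap at \<open>w'\<close> (\<open>gap_le_dual_value\<close>), in two ways according
  to whether the stopping index is below a large fixed \<open>N\<close>.

  If the method runs for at least \<open>N\<close> steps, the usual regret estimate for gradient descent in the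
  metrics \<open>\<alpha>\<^sub>n \<parallel>w\<parallel>\<^sup>2 + \<parallel>A\<^sup>* w\<parallel>\<^sup>2\<close>, which decrease with \<open>n\<close>, gives
  \<open>gap N \<le> gap(w') + O(1 / N) + O\<^sub>N(\<delta>)\<close> (\<open>gap_le_while_running\<close>), and the gap does not increase
  afterwards.  If it stops earlier, the stopping rule makes the residual of order \<open>\<delta>\<close>, with a
  constant depending on \<open>N\<close>, and convexity alone gives \<open>gap \<le> gap(w') + O\<^sub>N(\<delta>)\<close>
  (\<open>gap_le_if_stopped_early\<close>).  Choosing \<open>w'\<close>, then \<open>N\<close>, then \<open>\<delta>\<close> finishes the proof.
\<close>

section \<open>Minimizing lower semicontinuous strongly convex functions\<close>

text \<open>
  A real function on an explicit domain replaces the extended-real one, so that domains can be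
  intersected with closed convex sets and finite convex functions added without infinite
  arithmetic.  Closedness of the sublevel sets is lower semicontinuity of the extension by \<open>\<infinity>\<close>.
\<close>

definition lsc_strongly_convex_on :: "'a::real_inner set \<Rightarrow> ('a \<Rightarrow> real) \<Rightarrow> real \<Rightarrow> bool" where
  "lsc_strongly_convex_on D \<theta> c \<longleftrightarrow> D \<noteq> {} \<and> c > 0 \<and>
     (\<forall>u\<in>D. \<forall>x\<in>D. \<forall>s\<in>{0..1}. s *\<^sub>R u + (1 - s) *\<^sub>R x \<in> D \<and>
        \<theta> (s *\<^sub>R u + (1 - s) *\<^sub>R x) + c * s * (1 - s) * (norm (u - x))\<^sup>2 \<le> s * \<theta> u + (1 - s) * \<theta> x) \<and>
     (\<forall>M. closed {x\<in>D. \<theta> x \<le> M})"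

lemma lsc_strongly_convex_onD:
  assumes "lsc_strongly_convex_on D \<theta> c"
  shows "D \<noteq> {}" "c > 0"
    "\<And>u x s. u \<in> D \<Longrightarrow> x \<in> D \<Longrightarrow> 0 \<le> s \<Longrightarrow> s \<le> 1 \<Longrightarrow> s *\<^sub>R u + (1 - s) *\<^sub>R x \<in> D"
    "\<And>u x s. u \<in> D \<Longrightarrow> x \<in> D \<Longrightarrow> 0 \<le> s \<Longrightarrow> s \<le> 1 \<Longrightarrow>
       \<theta> (s *\<^sub>R u + (1 - s) *\<^sub>R x) + c * s * (1 - s) * (norm (u - x))\<^sup>2 \<le> s * \<theta> u + (1 - s) * \<theta> x"
    "\<And>M. closed {x\<in>D. \<theta> x \<le> M}"
  using assms unfolding lsc_strongly_convex_on_def by auto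

text \<open>
  This parallelogram-type identity says that \<open>\<parallel>x\<parallel>\<^sup>2\<close> is strongly convex with constant exactly \<open>1\<close>.
\<close>

lemma norm_sq_convex_combination:
  fixes u x :: "'a::real_inner"
  shows "(norm (s *\<^sub>R u + (1 - s) *\<^sub>R x))\<^sup>2 + s * (1 - s) * (norm (u - x))\<^sup>2
         = s * (norm u)\<^sup>2 + (1 - s) * (norm x)\<^sup>2"
  unfolding power2_norm_eq_inner
  by (simp add: inner_add_left inner_add_right inner_diff_left inner_diff_right inner_commute algebra_simps)

lemma lsc_strongly_convex_on_norm_sq:
  assumes "a > 0"
  shows "lsc_strongly_convex_on UNIV (\<lambda>x::'a::real_inner. a * (norm x)\<^sup>2) a"
proof -
  have "a * (norm (s *\<^sub>R u + (1 - s) *\<^sub>R x))\<^sup>2 + a * s * (1 - s) * (norm (u - x))\<^sup>2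
         = s * (a * (norm u)\<^sup>2) + (1 - s) * (a * (norm x)\<^sup>2)" for s and u x :: 'a
    using arg_cong[OF norm_sq_convex_combination[of s u x], of "\<lambda>z. a * z"] by (simp add: algebra_simps)
  moreover have "closed {x::'a. a * (norm x)\<^sup>2 \<le> M}" for M
    by (intro closed_Collect_le continuous_intros)
  ultimately show ?thesis using assms unfolding lsc_strongly_convex_on_def by auto
qed

lemma lsc_strongly_convex_on_add:
  assumes "lsc_strongly_convex_on D \<theta> c" and "convex_on UNIV g" and "continuous_on UNIV g"
  shows "lsc_strongly_convex_on D (\<lambda>x. \<theta> x + g x) c"
proof -
  note th = lsc_strongly_convex_onD[OF assms(1)]
  have sconv: "\<theta> (s *\<^sub>R u + (1 - s) *\<^sub>R x) + g (s *\<^sub>R u + (1 - s) *\<^sub>R x) + c * s * (1 - s) * (norm (u - x))\<^sup>2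
      \<le> s * (\<theta> u + g u) + (1 - s) * (\<theta> x + g x)" if "u \<in> D" "x \<in> D" "0 \<le> s" "s \<le> 1" for u x s
  proof -
    have "g (s *\<^sub>R u + (1 - s) *\<^sub>R x) \<le> s * g u + (1 - s) * g x"
      using assms(2) that unfolding convex_on_def by auto
    then show ?thesis using th(4)[OF that] by (simp add: algebra_simps)
  qed
  have clos: "closed {x\<in>D. \<theta> x + g x \<le> M}" for M
    unfolding closed_sequential_limits
  proof (intro allI impI, elim conjE)
    fix X l assume X: "\<forall>n. X n \<in> {x\<in>D. \<theta> x + g x \<le> M}" and lim: "X \<longlonglongrightarrow> l"
    have glim: "(\<lambda>n. g (X n)) \<longlonglongrightarrow> g l"
      by (rule continuous_on_tendsto_compose[OF assms(3) lim]) auto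
    have le: "l \<in> D \<and> \<theta> l \<le> M - g l + e" if "e > 0" for e
    proof -
      have "\<forall>\<^sub>F n in sequentially. g l - e < g (X n)"
        using order_tendstoD(1)[OF glim] that by simp
      then have "\<forall>\<^sub>F n in sequentially. X n \<in> {x\<in>D. \<theta> x \<le> M - g l + e}"
      proof (rule eventually_mono)
        fix n assume "g l - e < g (X n)"
        moreover have "X n \<in> D" "\<theta> (X n) + g (X n) \<le> M" using X by auto
        ultimately show "X n \<in> {x\<in>D. \<theta> x \<le> M - g l + e}" by simp
      qed
      from Lim_in_closed_set[OF th(5) this _ lim] show ?thesis by simp
    qed
    have "\<theta> l \<le> M - g l" by (rule field_le_epsilon) (use le in auto)
    then show "l \<in> {x\<in>D. \<theta> x + g x \<le> M}" using le[of 1] by simp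
  qed
  show ?thesis using th sconv clos unfolding lsc_strongly_convex_on_def by auto
qed

lemma lsc_strongly_convex_on_Int:
  assumes "lsc_strongly_convex_on D \<theta> c" and "closed S" "convex S" "D \<inter> S \<noteq> {}"
  shows "lsc_strongly_convex_on (D \<inter> S) \<theta> c"
proof -
  note th = lsc_strongly_convex_onD[OF assms(1)]
  have "{x \<in> D \<inter> S. \<theta> x \<le> M} = {x\<in>D. \<theta> x \<le> M} \<inter> S" for M by auto
  then have "closed {x \<in> D \<inter> S. \<theta> x \<le> M}" for M using th(5) assms(2) by auto
  moreover have "s *\<^sub>R u + (1 - s) *\<^sub>R x \<in> S" if "u \<in> S" "x \<in> S" "0 \<le> s" "s \<le> 1" for u x s
    using that assms(3) unfolding convex_def by auto
  ultimately show ?thesis using th assms(4) unfolding lsc_strongly_convex_on_def by auto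
qed

text \<open>
  Near a domain point \<open>x0\<close> lower semicontinuity bounds \<open>\<theta>\<close> from below.  A far point \<open>x\<close> is joined to
  \<open>x0\<close>; the point of the segment at distance \<open>r\<close> from \<open>x0\<close> already has a value above \<open>\<theta> x0 - 1\<close>, and strong
  convexity then forces quadratic growth at \<open>x\<close>, which beats the linear loss.
\<close>

lemma lsc_strongly_convex_on_bounded_below:
  assumes "lsc_strongly_convex_on D \<theta> c"
  shows "\<exists>m. \<forall>x\<in>D. m \<le> \<theta> x"
proof -
  note th = lsc_strongly_convex_onD[OF assms]
  obtain x0 where x0: "x0 \<in> D" using th(1) by auto
  have "open (- {x\<in>D. \<theta> x \<le> \<theta> x0 - 1})" using th(5) by auto
  then obtain \<rho> where \<rho>: "\<rho> > 0" "ball x0 \<rho> \<subseteq> - {x\<in>D. \<theta> x \<le> \<theta> x0 - 1}"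
    using openE[of "- {x\<in>D. \<theta> x \<le> \<theta> x0 - 1}" x0] by auto
  define r where "r = \<rho> / 2"
  have near: "\<theta> x > \<theta> x0 - 1" if "x \<in> D" "norm (x - x0) \<le> r" for x
  proof -
    have "x \<in> ball x0 \<rho>" using that \<rho>(1) unfolding r_def by (simp add: dist_norm norm_minus_commute)
    then show ?thesis using \<rho>(2) that(1) by auto
  qed
  have r: "r > 0" using \<rho> r_def by simp
  (* The bound for far points is the concave quadratic b d - c d^2 in the distance d; its
     maximum over d is b^2 / (4 c). *)
  define b where "b = c * r + 1 / r"
  have "\<theta> x0 - 1 - b\<^sup>2 / (4 * c) \<le> \<theta> x" if x: "x \<in> D" for x
  proof (cases "norm (x - x0) \<le> r")
    case True
    have "0 \<le> b\<^sup>2 / (4 * c)" using th(2) by simp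
    then show ?thesis using near[OF x True] by linarith
  next
    case False
    define d where "d = norm (x - x0)"
    define s where "s = r / d"
    have d: "d > r" using False d_def by simp
    have s: "0 < s" "s \<le> 1" using d r unfolding s_def by auto
    have "norm (s *\<^sub>R x + (1 - s) *\<^sub>R x0 - x0) = norm (s *\<^sub>R (x - x0))"
      by (simp add: algebra_simps)
    also have "\<dots> = s * d" using s by (simp add: d_def)
    also have "\<dots> = r" using d r unfolding s_def by simp
    finally have "\<theta> (s *\<^sub>R x + (1 - s) *\<^sub>R x0) > \<theta> x0 - 1"
      using near th(3)[OF x x0, of s] s by simp
    then have "\<theta> x0 - 1 + c * s * (1 - s) * d\<^sup>2 \<le> s * \<theta> x + (1 - s) * \<theta> x0"
      using th(4)[OF x x0, of s] s unfolding d_def by linarith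
    then have "s * (\<theta> x0 - \<theta> x) \<le> 1 - c * s * (1 - s) * d\<^sup>2" by (simp add: algebra_simps)
    then have "d / r * (s * (\<theta> x0 - \<theta> x)) \<le> d / r * (1 - c * s * (1 - s) * d\<^sup>2)"
      using d r by (intro mult_left_mono) auto
    moreover have "d / r * (s * (\<theta> x0 - \<theta> x)) = \<theta> x0 - \<theta> x"
      using d r unfolding s_def by simp
    moreover have "d / r * (1 - c * s * (1 - s) * d\<^sup>2) = d / r - c * (d\<^sup>2 - r * d)"
      using d r unfolding s_def by (simp add: field_simps power2_eq_square)
    ultimately have "\<theta> x0 - \<theta> x \<le> d / r - c * (d\<^sup>2 - r * d)" by simp
    also have "\<dots> = b * d - c * d\<^sup>2" unfolding b_def by (simp add: algebra_simps)
    also have "\<dots> \<le> b\<^sup>2 / (4 * c)"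
    proof -
      have "0 \<le> (b - 2 * c * d)\<^sup>2" by simp
      then show ?thesis using th(2) by (simp add: field_simps power2_eq_square)
    qed
    finally show ?thesis by linarith
  qed
  then show ?thesis by blast
qed

text \<open>
  The common last step of the two completeness arguments below: strong convexity turns a small
  difference of function values into a small squared distance.
\<close>

lemma convergent_if_sq_dist_le_null:
  fixes x :: "nat \<Rightarrow> 'a::{real_normed_vector,complete_space}"
  assumes "c > 0" and "\<And>k l. k \<le> l \<Longrightarrow> c * (norm (x l - x k))\<^sup>2 \<le> e k" and "e \<longlonglongrightarrow> 0"
  shows "convergent x"
proof -
  have "Cauchy x"
  proof (rule metric_CauchyI)
    fix \<epsilon> :: real assume \<epsilon>: "\<epsilon> > 0"
    then have "c * (\<epsilon> / 2)\<^sup>2 > 0" using assms(1) by simp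
    then have "\<forall>\<^sub>F k in sequentially. e k < c * (\<epsilon> / 2)\<^sup>2"
      using order_tendstoD(2)[OF assms(3)] by blast
    then obtain K where K: "e K < c * (\<epsilon> / 2)\<^sup>2" unfolding eventually_sequentially by auto
    have near: "norm (x l - x K) < \<epsilon> / 2" if "K \<le> l" for l
    proof -
      have "c * (norm (x l - x K))\<^sup>2 < c * (\<epsilon> / 2)\<^sup>2" using assms(2)[OF that] K by linarith
      then have "(norm (x l - x K))\<^sup>2 < (\<epsilon> / 2)\<^sup>2" using assms(1) by simp
      then show ?thesis using power2_less_imp_less[of "norm (x l - x K)" "\<epsilon> / 2"] \<epsilon> by simp
    qed
    have "dist (x m) (x n) < \<epsilon>" if "m \<ge> K" "n \<ge> K" for m n
      by (rule dist_triangle_half_l[of _ "x K"]) (use near that in \<open>simp_all add: dist_norm\<close>)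
    then show "\<exists>M. \<forall>m\<ge>M. \<forall>n\<ge>M. dist (x m) (x n) < \<epsilon>" by blast
  qed
  then show ?thesis by (simp add: Cauchy_convergent)
qed

text \<open>
  Strong convexity at the midpoint of two terms of a minimizing sequence shows that the sequence
  is Cauchy; its limit stays in every sublevel set above the infimum.
\<close>

lemma minimizer_exists:
  fixes \<theta> :: "'a::{real_inner,complete_space} \<Rightarrow> real"
  assumes "lsc_strongly_convex_on D \<theta> c"
  shows "\<exists>x\<in>D. \<forall>u\<in>D. \<theta> x \<le> \<theta> u"
proof -
  note th = lsc_strongly_convex_onD[OF assms]
  have bdd: "bdd_below (\<theta> ` D)" using lsc_strongly_convex_on_bounded_below[OF assms] by (auto simp: bdd_below_def)
  define m where "m = Inf (\<theta> ` D)"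
  have m: "m \<le> \<theta> u" if "u \<in> D" for u unfolding m_def using that bdd by (auto intro: cInf_lower)
  have "\<exists>u\<in>D. \<theta> u < m + 1 / Suc n" for n
  proof -
    have "Inf (\<theta> ` D) < m + 1 / Suc n" unfolding m_def by simp
    from cInf_lessD[OF _ this] show ?thesis using th(1) by blast
  qed
  then have "\<forall>n. \<exists>u. u \<in> D \<and> \<theta> u < m + 1 / Suc n" by blast
  from choice[OF this] obtain x where "\<forall>n. x n \<in> D \<and> \<theta> (x n) < m + 1 / Suc n" ..
  then have x: "\<And>n. x n \<in> D" "\<And>n. \<theta> (x n) < m + 1 / Suc n" by blast+
  have null: "(\<lambda>n. 1 / real (Suc n)) \<longlonglongrightarrow> 0" by (rule LIMSEQ_Suc[OF lim_1_over_n])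
  have cau: "c / 4 * (norm (x l - x k))\<^sup>2 \<le> 1 / Suc k" if "k \<le> l" for k l
  proof -
    have mid: "(1/2) *\<^sub>R x l + (1 - 1/2) *\<^sub>R x k \<in> D" using th(3)[OF x(1) x(1), of "1/2"] by simp
    have "1 / real (Suc l) \<le> 1 / real (Suc k)" using that by (simp add: field_simps)
    then show ?thesis
      using th(4)[OF x(1)[of l] x(1)[of k], of "1/2"] m[OF mid] x(2)[of l] x(2)[of k] by simp
  qed
  have "convergent x"
    by (rule convergent_if_sq_dist_le_null[OF _ cau null]) (use th(2) in simp)
  then obtain z where z: "x \<longlonglongrightarrow> z" unfolding convergent_def by auto
  have le: "z \<in> D \<and> \<theta> z \<le> m + e" if e: "e > 0" for e
  proof -
    have "\<forall>\<^sub>F n in sequentially. 1 / real (Suc n) < e"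
      by (rule order_tendstoD(2)[OF null e])
    then have "\<forall>\<^sub>F n in sequentially. x n \<in> {x\<in>D. \<theta> x \<le> m + e}"
    proof (rule eventually_mono)
      fix n assume "1 / real (Suc n) < e"
      then show "x n \<in> {x\<in>D. \<theta> x \<le> m + e}" using x(1)[of n] x(2)[of n] by simp
    qed
    from Lim_in_closed_set[OF th(5) this _ z] show ?thesis by simp
  qed
  have "\<theta> z \<le> m" by (rule field_le_epsilon) (use le in auto)
  then show ?thesis using m le[of 1] by force
qed

text \<open>
  Variational inequalities are obtained by moving a fraction \<open>s\<close> towards a competitor, dividing
  by \<open>s\<close> and letting \<open>s\<close> tend to \<open>0\<close>; this is the limit.
\<close>

lemma le_if_le_plus_small_multiple:
  fixes a b C :: real
  assumes "\<And>s. 0 < s \<Longrightarrow> s \<le> 1 \<Longrightarrow> a \<le> b + s * C"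
  shows "a \<le> b"
proof -
  have "((\<lambda>s. b + s * C) \<longlongrightarrow> b + 0 * C) (at_right 0)" by (intro tendsto_intros)
  moreover have "\<forall>\<^sub>F s in at_right (0::real). a \<le> b + s * C"
    unfolding eventually_at_right_field using assms by (intro exI[of _ 1]) auto
  ultimately show ?thesis by (simp add: tendsto_lowerbound)
qed

lemma minimizer_quadratic_growth:
  assumes "lsc_strongly_convex_on D \<theta> c" and x: "x \<in> D" and min: "\<And>u. u \<in> D \<Longrightarrow> \<theta> x \<le> \<theta> u" and u: "u \<in> D"
  shows "\<theta> x + c * (norm (u - x))\<^sup>2 \<le> \<theta> u"
proof (rule le_if_le_plus_small_multiple)
  fix s :: real assume s: "0 < s" "s \<le> 1"
  note th = lsc_strongly_convex_onD[OF assms(1)]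
  have "\<theta> x \<le> \<theta> (s *\<^sub>R u + (1 - s) *\<^sub>R x)" using min th(3)[OF u x, of s] s by simp
  then have "s * (\<theta> x + c * (norm (u - x))\<^sup>2) \<le> s * (\<theta> u + s * (c * (norm (u - x))\<^sup>2))"
    using th(4)[OF u x, of s] s by (simp add: algebra_simps)
  then show "\<theta> x + c * (norm (u - x))\<^sup>2 \<le> \<theta> u + s * (c * (norm (u - x))\<^sup>2)" using s by simp
qed

section \<open>Adjoints and the regularized inverse\<close>

lemma convex_on_norm_sq_linear:
  fixes T :: "'a::real_inner \<Rightarrow> 'b::real_inner"
  assumes "linear T" and "0 \<le> k"
  shows "convex_on UNIV (\<lambda>x. k * (norm (T x - b))\<^sup>2)"
proof (rule convex_onI)
  fix s :: real and x u :: 'a assume s: "0 < s" "s < 1"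
  have eq: "T ((1 - s) *\<^sub>R x + s *\<^sub>R u) - b = s *\<^sub>R (T u - b) + (1 - s) *\<^sub>R (T x - b)"
    unfolding linear_add[OF assms(1)] linear_scale[OF assms(1)] by (simp add: algebra_simps)
  have "0 \<le> s * (1 - s) * (norm ((T u - b) - (T x - b)))\<^sup>2" using s by simp
  then have "(norm (T ((1 - s) *\<^sub>R x + s *\<^sub>R u) - b))\<^sup>2 \<le> s * (norm (T u - b))\<^sup>2 + (1 - s) * (norm (T x - b))\<^sup>2"
    unfolding eq using norm_sq_convex_combination[of s "T u - b" "T x - b"] by linarith
  from mult_left_mono[OF this assms(2)]
  show "k * (norm (T ((1 - s) *\<^sub>R x + s *\<^sub>R u) - b))\<^sup>2 \<le> (1 - s) * (k * (norm (T x - b))\<^sup>2) + s * (k * (norm (T u - b))\<^sup>2)"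
    by (simp add: algebra_simps)
qed auto

lemma convex_on_linear:
  assumes "linear l" shows "convex_on UNIV (\<lambda>x. l x :: real)"
  by (rule convex_onI) (simp_all add: linear_add[OF assms] linear_scale[OF assms])

lemma norm_sq_along_line:
  fixes b :: "'a::real_inner"
  shows "(norm (b + s *\<^sub>R d))\<^sup>2 = (norm b)\<^sup>2 + 2 * s * (b \<bullet> d) + s\<^sup>2 * (norm d)\<^sup>2"
  unfolding power2_norm_eq_inner
  by (simp add: inner_add_left inner_add_right inner_commute power2_eq_square algebra_simps)

text \<open>
  The form \<open>a (z \<bullet> h) + T z \<bullet> T h\<close> is symmetric and coercive, so the solution is the minimizer of
  \<open>a \<parallel>z\<parallel>\<^sup>2 + \<parallel>T z\<parallel>\<^sup>2 - 2 l z\<close>.  With \<open>T = 0\<close> this is the Riesz representation theorem, which yields adjoints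
  in Hilbert space; with \<open>T = A\<^sup>*\<close> it makes \<open>a I + A A\<^sup>*\<close> surjective.
\<close>

lemma Lax_Milgram_symmetric:
  fixes T :: "'a::{real_inner,complete_space} \<Rightarrow> 'b::real_inner" and l :: "'a \<Rightarrow> real"
  assumes "a > 0" and T: "bounded_linear T" and l: "bounded_linear l"
  shows "\<exists>z. \<forall>h. a * (z \<bullet> h) + T z \<bullet> T h = l h"
proof -
  have Tl: "linear T" "linear l" using T l bounded_linear.linear by auto
  define J where "J = (\<lambda>z. a * (norm z)\<^sup>2 + (norm (T z))\<^sup>2 + (- 2 * l z))"
  have lin: "linear (\<lambda>z. - 2 * l z)"
    using bounded_linear.linear[OF bounded_linear_const_mult[OF l]] by blast
  have cont: "continuous_on UNIV T" "continuous_on UNIV l"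
    using T l by (auto intro: linear_continuous_on)
  have "lsc_strongly_convex_on UNIV (\<lambda>z. a * (norm z)\<^sup>2 + (norm (T z))\<^sup>2) a"
    using lsc_strongly_convex_on_add[OF lsc_strongly_convex_on_norm_sq[OF assms(1)] convex_on_norm_sq_linear[OF Tl(1), of 1 0]] cont
    by (simp add: continuous_intros)
  from lsc_strongly_convex_on_add[OF this convex_on_linear[OF lin]]
  have "lsc_strongly_convex_on UNIV J a" unfolding J_def using cont by (simp add: continuous_intros)
  from minimizer_exists[OF this] obtain z where z: "\<And>u. J z \<le> J u" by auto
  have ge: "0 \<le> a * (z \<bullet> h) + T z \<bullet> T h - l h" for h
  proof (rule le_if_le_plus_small_multiple)
    fix s :: real assume s: "0 < s" "s \<le> 1"
    have "J (z + s *\<^sub>R h) - J z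
        = s * (2 * (a * (z \<bullet> h) + T z \<bullet> T h - l h) + s * (a * (norm h)\<^sup>2 + (norm (T h))\<^sup>2))"
      unfolding J_def linear_add[OF Tl(1)] linear_scale[OF Tl(1)] linear_add[OF Tl(2)] linear_scale[OF Tl(2)]
        norm_sq_along_line by (simp add: algebra_simps power2_eq_square)
    then have "0 \<le> s * (2 * (a * (z \<bullet> h) + T z \<bullet> T h - l h) + s * (a * (norm h)\<^sup>2 + (norm (T h))\<^sup>2))"
      using z[of "z + s *\<^sub>R h"] by simp
    then have "0 \<le> 2 * (a * (z \<bullet> h) + T z \<bullet> T h - l h) + s * (a * (norm h)\<^sup>2 + (norm (T h))\<^sup>2)"
      using s by (simp add: zero_le_mult_iff)
    then show "0 \<le> a * (z \<bullet> h) + T z \<bullet> T h - l h + s * ((a * (norm h)\<^sup>2 + (norm (T h))\<^sup>2) / 2)"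
      by (simp add: field_simps)
  qed
  (* The inequality for h and for - h together gives equality. *)
  have "a * (z \<bullet> h) + T z \<bullet> T h = l h" for h
    using ge[of h] ge[of "- h"] by (simp add: linear_neg[OF Tl(1)] linear_neg[OF Tl(2)])
  then show ?thesis by blast
qed

lemma inner_adjoint:
  fixes A :: "'a::{real_inner,complete_space} \<Rightarrow> 'b::real_inner"
  assumes "bounded_linear A"
  shows "A x \<bullet> w = x \<bullet> adjoint A w"
proof -
  have "\<exists>z. \<forall>x. A x \<bullet> w = x \<bullet> z" for w
  proof -
    have "bounded_linear (\<lambda>x. A x \<bullet> w)"
      using bounded_linear_compose[OF bounded_linear_inner_left assms] .
    from Lax_Milgram_symmetric[OF zero_less_one bounded_linear_zero this]
    obtain z where "\<And>h. z \<bullet> h = A h \<bullet> w" by auto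
    then show ?thesis by (metis inner_commute)
  qed
  then have "\<exists>f'. \<forall>x w. A x \<bullet> w = x \<bullet> f' w" by metis
  then show ?thesis unfolding adjoint_def by (rule someI2_ex) blast
qed

lemma bounded_linear_adjoint:
  fixes A :: "'a::{real_inner,complete_space} \<Rightarrow> 'b::real_inner"
  assumes "bounded_linear A"
  shows "bounded_linear (adjoint A)"
proof -
  note adj = inner_adjoint[OF assms, symmetric]
  obtain K where K: "\<And>x. norm (A x) \<le> norm x * K" and K0: "K > 0"
    using bounded_linear.pos_bounded[OF assms] by blast
  show ?thesis
  proof (rule bounded_linear_intro[where K = K])
    show "adjoint A (u + w) = adjoint A u + adjoint A w" for u w
      by (rule vector_eq_ldot[THEN iffD1]) (simp add: adj inner_add_right)
    show "adjoint A (s *\<^sub>R w) = s *\<^sub>R adjoint A w" for s w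
      by (rule vector_eq_ldot[THEN iffD1]) (simp add: adj)
    show "norm (adjoint A w) \<le> norm w * K" for w
    proof -
      have "(norm (adjoint A w))\<^sup>2 = A (adjoint A w) \<bullet> w" by (simp add: adj power2_norm_eq_inner)
      also have "\<dots> \<le> norm (A (adjoint A w)) * norm w" by (rule norm_cauchy_schwarz)
      also have "\<dots> \<le> norm (adjoint A w) * K * norm w" by (intro mult_right_mono K) simp
      finally have "norm (adjoint A w) * norm (adjoint A w) \<le> norm (adjoint A w) * (norm w * K)"
        by (simp add: power2_eq_square mult_ac)
      then show ?thesis using K0 by (cases "norm (adjoint A w) = 0") auto
    qed
  qed
qed

lemma reg_inv_solves:
  fixes A :: "'a::{real_inner,complete_space} \<Rightarrow> 'b::{real_inner,complete_space}"
  assumes A: "bounded_linear A" and a: "a > 0"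
  shows "a *\<^sub>R reg_inv A a r + A (adjoint A (reg_inv A a r)) = r"
proof -
  have "\<exists>z. a *\<^sub>R z + A (adjoint A z) = r" for r
  proof -
    obtain z where "\<forall>h. a * (z \<bullet> h) + adjoint A z \<bullet> adjoint A h = r \<bullet> h"
      using Lax_Milgram_symmetric[OF a bounded_linear_adjoint[OF A] bounded_linear_inner_right[of r]] by blast
    then have "a *\<^sub>R z + A (adjoint A z) = r"
      by (intro vector_eq_rdot[THEN iffD1]) (simp add: inner_add_left inner_adjoint[OF A])
    then show ?thesis by blast
  qed
  then have "surj (\<lambda>z. a *\<^sub>R z + A (adjoint A z))" unfolding surj_def by (simp add: eq_commute)
  from surj_f_inv_f[OF this, of r] show ?thesis unfolding reg_inv_def .
qed

section \<open>Absence of a duality gap\<close>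

definition subgradient_on :: "'a::real_inner set \<Rightarrow> ('a \<Rightarrow> real) \<Rightarrow> 'a \<Rightarrow> 'a \<Rightarrow> bool" where
  "subgradient_on D \<theta> \<xi> x \<longleftrightarrow> x \<in> D \<and> (\<forall>u\<in>D. \<theta> x + \<xi> \<bullet> (u - x) \<le> \<theta> u)"

text \<open>
  The first-order condition at a minimizer of the penalized problem: \<open>\<theta>\<close> has the subgradient
  \<open>\<xi> - 2 k A\<^sup>* (A x - y)\<close> there, so penalization produces subgradients in \<open>\<xi>\<close> plus the range of \<open>A\<^sup>*\<close>.
\<close>

lemma penalty_minimizer_subgradient:
  assumes "lsc_strongly_convex_on D \<theta> c" and A: "bounded_linear A" and x: "x \<in> D"
    and min: "\<And>u. u \<in> D \<Longrightarrow>
      \<theta> x - \<xi> \<bullet> x + k * (norm (A x - y))\<^sup>2 \<le> \<theta> u - \<xi> \<bullet> u + k * (norm (A u - y))\<^sup>2"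
  shows "\<And>u. u \<in> D \<Longrightarrow> \<theta> x + \<xi> \<bullet> (u - x) - 2 * k * ((A x - y) \<bullet> A (u - x)) \<le> \<theta> u"
proof (rule le_if_le_plus_small_multiple)
  fix u and s :: real assume u: "u \<in> D" and s: "0 < s" "s \<le> 1"
  note th = lsc_strongly_convex_onD[OF assms(1)]
  have lin: "linear A" using A bounded_linear.linear by auto
  define v where "v = s *\<^sub>R u + (1 - s) *\<^sub>R x"
  have v: "v = x + s *\<^sub>R (u - x)" unfolding v_def by (simp add: algebra_simps)
  have Av: "A v - y = (A x - y) + s *\<^sub>R A (u - x)"
    unfolding v linear_add[OF lin] linear_scale[OF lin] by simp
  have "0 \<le> c * s * (1 - s) * (norm (u - x))\<^sup>2" using th(2) s by simp
  then have "\<theta> v \<le> s * \<theta> u + (1 - s) * \<theta> x" using th(4)[OF u x, of s] s unfolding v_def by simp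
  moreover have "\<theta> x - \<xi> \<bullet> x + k * (norm (A x - y))\<^sup>2 \<le> \<theta> v - \<xi> \<bullet> v + k * (norm (A v - y))\<^sup>2"
    using min[of v] th(3)[OF u x, of s] s unfolding v_def by simp
  moreover have "\<xi> \<bullet> v = \<xi> \<bullet> x + s * (\<xi> \<bullet> (u - x))" unfolding v by (simp add: inner_add_right)
  ultimately have "s * (\<theta> x + \<xi> \<bullet> (u - x) - 2 * k * ((A x - y) \<bullet> A (u - x)))
      \<le> s * (\<theta> u + s * (k * (norm (A (u - x)))\<^sup>2))"
    unfolding Av norm_sq_along_line by (simp add: algebra_simps power2_eq_square)
  then show "\<theta> x + \<xi> \<bullet> (u - x) - 2 * k * ((A x - y) \<bullet> A (u - x)) \<le> \<theta> u + s * (k * (norm (A (u - x)))\<^sup>2)"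
    using s by simp
qed

text \<open>
  The dual problem need not attain its optimum, but its value is that of the primal one.  The
  minimizers \<open>x k\<close> of the problem with penalty \<open>k \<parallel>A x - y\<parallel>\<^sup>2\<close> have optimal values that increase and are
  bounded by the value at \<open>p\<close>; by quadratic growth they converge, and the limit is feasible.  Were
  their values \<open>F (x k)\<close> to stay below \<open>F p - e\<close>, so would that of the limit, against the minimality of \<open>p\<close>.
  At an \<open>x k\<close> with \<open>F (x k) > F p - e\<close> the dual variable \<open>2 k (A x - y)\<close> has gap at most \<open>e\<close>.
\<close>

lemma zero_duality_gap:
  fixes A :: "'a::{real_inner,complete_space} \<Rightarrow> 'b::real_inner"
  assumes lsc: "lsc_strongly_convex_on D \<theta> c" and A: "bounded_linear A"
    and p: "p \<in> D" "A p = y"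
    and pmin: "\<And>u. u \<in> D \<Longrightarrow> A u = y \<Longrightarrow> \<theta> p - \<xi> \<bullet> p \<le> \<theta> u - \<xi> \<bullet> u"
    and e: "e > 0"
  shows "\<exists>w z. subgradient_on D \<theta> (\<xi> - adjoint A w) z \<and>
           \<theta> p - \<theta> z - (\<xi> - adjoint A w) \<bullet> (p - z) \<le> e"
proof -
  have lin: "linear A" "linear (\<lambda>x. - (\<xi> \<bullet> x))"
    using A bounded_linear.linear bounded_linear_minus[OF bounded_linear_inner_right] by blast+
  have cont: "continuous_on UNIV A" using A by (rule linear_continuous_on)
  define F where "F = (\<lambda>x. \<theta> x + - (\<xi> \<bullet> x))"
  define R where "R = (\<lambda>x. (norm (A x - y))\<^sup>2)"
  have F: "lsc_strongly_convex_on D F c" unfolding F_def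
    by (rule lsc_strongly_convex_on_add[OF lsc convex_on_linear[OF lin(2)]]) (intro continuous_intros)
  note Fd = lsc_strongly_convex_onD[OF F]
  have Fk: "lsc_strongly_convex_on D (\<lambda>x. F x + real k * R x) c" for k
    unfolding R_def
    by (rule lsc_strongly_convex_on_add[OF F convex_on_norm_sq_linear[OF lin(1)]]) (intro continuous_intros cont | simp)+
  have "\<forall>k. \<exists>x. x \<in> D \<and> (\<forall>u\<in>D. F x + real k * R x \<le> F u + real k * R u)"
    using minimizer_exists[OF Fk] by blast
  from choice[OF this] obtain x where
    x: "\<And>k. x k \<in> D" and xmin: "\<And>k u. u \<in> D \<Longrightarrow> F (x k) + real k * R (x k) \<le> F u + real k * R u"
    by blast
  define v where "v = (\<lambda>k. F (x k) + real k * R (x k))"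
  have grow: "v k + c * (norm (x l - x k))\<^sup>2 \<le> v l" if "k \<le> l" for k l
  proof -
    have "v k + c * (norm (x l - x k))\<^sup>2 \<le> F (x l) + real k * R (x l)"
      unfolding v_def by (rule minimizer_quadratic_growth[OF Fk x xmin x])
    also have "\<dots> \<le> v l" unfolding v_def using that by (simp add: R_def mult_right_mono)
    finally show ?thesis .
  qed
  have v_le: "v k \<le> F p" for k unfolding v_def using xmin[OF p(1), of k] p(2) by (simp add: R_def)
  have "incseq v"
  proof (rule incseq_SucI)
    show "v k \<le> v (Suc k)" for k
    proof -
      have "0 \<le> c * (norm (x (Suc k) - x k))\<^sup>2" using Fd(2) by simp
      then show ?thesis using grow[of k "Suc k"] by simp
    qed
  qed
  then obtain L where L: "v \<longlonglongrightarrow> L" "\<And>k. v k \<le> L"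
    using incseq_convergent[of v "F p"] v_le by blast
  have "convergent x"
  proof (rule convergent_if_sq_dist_le_null[OF Fd(2)])
    show "c * (norm (x l - x k))\<^sup>2 \<le> L - v k" if "k \<le> l" for k l using grow[OF that] L(2)[of l] by linarith
    show "(\<lambda>k. L - v k) \<longlonglongrightarrow> 0" using tendsto_diff[OF tendsto_const L(1), of L] by simp
  qed
  then obtain q where q: "x \<longlonglongrightarrow> q" unfolding convergent_def by auto
  have "\<exists>k. F p - e < F (x k)"
  proof (rule ccontr)
    assume "\<nexists>k. F p - e < F (x k)"
    then have le: "F (x k) \<le> F p - e" for k by (simp add: not_less)
    then have "\<forall>\<^sub>F k in sequentially. x k \<in> {u\<in>D. F u \<le> F p - e}" using x by simp
    from Lim_in_closed_set[OF Fd(5) this _ q] have qD: "q \<in> D" "F q \<le> F p - e" by auto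
    obtain m where m: "\<And>u. u \<in> D \<Longrightarrow> m \<le> F u" using lsc_strongly_convex_on_bounded_below[OF F] by blast
    have "R (x (Suc k)) \<le> (F p - m) / real (Suc k)" for k
    proof -
      have "real (Suc k) * R (x (Suc k)) \<le> F p - m"
        using v_le[of "Suc k"] m[OF x[of "Suc k"]] unfolding v_def by linarith
      then show ?thesis by (simp add: field_simps)
    qed
    moreover have "(\<lambda>k. (F p - m) / real (Suc k)) \<longlonglongrightarrow> 0"
      using LIMSEQ_Suc[OF lim_const_over_n] .
    moreover have "(\<lambda>k. R (x (Suc k))) \<longlonglongrightarrow> R q"
    proof -
      have "(\<lambda>k. A (x (Suc k))) \<longlonglongrightarrow> A q" by (rule bounded_linear.tendsto[OF A LIMSEQ_Suc[OF q]])
      then show ?thesis unfolding R_def by (intro tendsto_intros)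
    qed
    ultimately have "R q \<le> 0" by (intro LIMSEQ_le[where X = "\<lambda>k. R (x (Suc k))"]) auto
    then have "A q = y" unfolding R_def by simp
    from pmin[OF qD(1) this] qD(2) e show False unfolding F_def by simp
  qed
  then obtain k where k: "F p - e < F (x k)" by blast
  define w where "w = (2 * real k) *\<^sub>R (A (x k) - y)"
  have w: "(\<xi> - adjoint A w) \<bullet> h = \<xi> \<bullet> h - 2 * real k * ((A (x k) - y) \<bullet> A h)" for h
  proof -
    have "adjoint A w \<bullet> h = w \<bullet> A h" using inner_adjoint[OF A, of h w] by (simp add: inner_commute)
    also have "\<dots> = 2 * real k * ((A (x k) - y) \<bullet> A h)" by (simp only: w_def inner_scaleR_left)
    finally show ?thesis by (simp only: inner_diff_left)
  qed
  have "subgradient_on D \<theta> (\<xi> - adjoint A w) (x k)"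
    unfolding subgradient_on_def w
    using penalty_minimizer_subgradient[OF lsc A x[of k], of \<xi> "real k" y] xmin[of _ k] x[of k]
    unfolding F_def R_def by (simp add: algebra_simps)
  moreover have "\<theta> p - \<theta> (x k) - (\<xi> - adjoint A w) \<bullet> (p - x k) \<le> e"
  proof -
    have "(A (x k) - y) \<bullet> A (p - x k) = - R (x k)"
      unfolding R_def power2_norm_eq_inner linear_diff[OF lin(1)] p(2)
      by (metis inner_minus_right minus_diff_eq)
    moreover have "0 \<le> real k * R (x k)" unfolding R_def by simp
    ultimately show ?thesis unfolding w using k unfolding F_def by (simp add: inner_diff_right)
  qed
  ultimately show ?thesis by blast
qed

section \<open>From extended-real to real-valued functions\<close>

lemma lsc_strongly_convex_on_real_part:
  fixes \<Theta> :: "'a::real_inner \<Rightarrow> ereal"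
  assumes pr: "proper \<Theta>" and lsc: "lower_semicontinuous \<Theta>" and "c > 0" and sc: "strongly_convex c \<Theta>"
  shows "lsc_strongly_convex_on {x. \<Theta> x < \<infinity>} (\<lambda>x. real_of_ereal (\<Theta> x)) c"
proof -
  have fin: "\<Theta> x = ereal (real_of_ereal (\<Theta> x))" if "\<Theta> x < \<infinity>" for x
    using that pr unfolding proper_def by (cases "\<Theta> x") auto
  have conv: "\<Theta> (s *\<^sub>R u + (1 - s) *\<^sub>R x) < \<infinity> \<and>
     real_of_ereal (\<Theta> (s *\<^sub>R u + (1 - s) *\<^sub>R x)) + c * s * (1 - s) * (norm (u - x))\<^sup>2
       \<le> s * real_of_ereal (\<Theta> u) + (1 - s) * real_of_ereal (\<Theta> x)"
    if "\<Theta> u < \<infinity>" "\<Theta> x < \<infinity>" "0 \<le> s" "s \<le> 1" for u x s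
  proof -
    have "\<Theta> (s *\<^sub>R u + (1 - s) *\<^sub>R x) + ereal (c * s * (1 - s) * (norm (u - x))\<^sup>2)
        \<le> ereal s * \<Theta> u + ereal (1 - s) * \<Theta> x"
      by (rule sc[unfolded strongly_convex_def, rule_format]) (use that in simp)
    also have "\<dots> = ereal (s * real_of_ereal (\<Theta> u) + (1 - s) * real_of_ereal (\<Theta> x))"
    proof -
      have "\<exists>a b. \<Theta> u = ereal a \<and> \<Theta> x = ereal b" using fin[OF that(1)] fin[OF that(2)] by blast
      then show ?thesis by auto
    qed
    finally have *: "\<Theta> (s *\<^sub>R u + (1 - s) *\<^sub>R x) + ereal (c * s * (1 - s) * (norm (u - x))\<^sup>2)
      \<le> ereal (s * real_of_ereal (\<Theta> u) + (1 - s) * real_of_ereal (\<Theta> x))" .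
    have lt: "\<Theta> (s *\<^sub>R u + (1 - s) *\<^sub>R x) < \<infinity>"
      using * by (cases "\<Theta> (s *\<^sub>R u + (1 - s) *\<^sub>R x)") auto
    have "\<exists>q. \<Theta> (s *\<^sub>R u + (1 - s) *\<^sub>R x) = ereal q" using fin[OF lt] by (rule exI)
    then show ?thesis using * by auto
  qed
  have clos: "closed {x \<in> {x. \<Theta> x < \<infinity>}. real_of_ereal (\<Theta> x) \<le> M}" for M
  proof -
    have eq: "{x \<in> {x. \<Theta> x < \<infinity>}. real_of_ereal (\<Theta> x) \<le> M} = {x. \<Theta> x \<le> ereal M}"
    proof -
      have "\<Theta> x < \<infinity> \<and> real_of_ereal (\<Theta> x) \<le> M \<longleftrightarrow> \<Theta> x \<le> ereal M" for x
        using pr unfolding proper_def by (cases "\<Theta> x") auto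
      then show ?thesis by simp
    qed
    have "open {x. \<not> \<Theta> x \<le> ereal M}"
    proof (subst open_subopen, intro ballI)
      fix x assume "x \<in> {x. \<not> \<Theta> x \<le> ereal M}"
      then have x: "\<not> \<Theta> x \<le> ereal M" by simp
      then have "ereal M < \<Theta> x" by simp
      also have "\<dots> \<le> Liminf (at x) \<Theta>" using lsc unfolding lower_semicontinuous_def ..
      finally have "ereal M < Liminf (at x) \<Theta>" .
      from less_LiminfD[OF this] obtain S where
        "open S" "x \<in> S" "\<And>z. z \<in> S \<Longrightarrow> z \<noteq> x \<Longrightarrow> ereal M < \<Theta> z"
        unfolding eventually_at_topological by blast
      then show "\<exists>T. open T \<and> x \<in> T \<and> T \<subseteq> {x. \<not> \<Theta> x \<le> ereal M}"
        using x by (intro exI[of _ S]) (auto simp: not_le)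
    qed
    then show ?thesis unfolding eq by (simp add: closed_def Collect_neg_eq)
  qed
  have "{x. \<Theta> x < \<infinity>} \<noteq> {}" using pr unfolding proper_def by auto
  then show ?thesis unfolding lsc_strongly_convex_on_def
  proof (intro conjI ballI allI)
    fix u x and s :: real assume "u \<in> {x. \<Theta> x < \<infinity>}" "x \<in> {x. \<Theta> x < \<infinity>}" "s \<in> {0..1}"
    then have "\<Theta> u < \<infinity>" "\<Theta> x < \<infinity>" "0 \<le> s" "s \<le> 1" by auto
    note * = conv[OF this]
    show "s *\<^sub>R u + (1 - s) *\<^sub>R x \<in> {x. \<Theta> x < \<infinity>}" using * by blast
    show "real_of_ereal (\<Theta> (s *\<^sub>R u + (1 - s) *\<^sub>R x)) + c * s * (1 - s) * (norm (u - x))\<^sup>2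
       \<le> s * real_of_ereal (\<Theta> u) + (1 - s) * real_of_ereal (\<Theta> x)" using * by blast
  qed (use clos \<open>c > 0\<close> in simp_all)
qed

text \<open>
  The growth inequality says at once that \<open>\<xi>\<close> is a subgradient at the tilted minimizer and that
  the Bregman distance to it dominates \<open>c\<close> times the squared norm distance.
\<close>

lemma tilted_min_quadratic_growth:
  fixes \<Theta> :: "'a::{real_inner,complete_space} \<Rightarrow> ereal"
  assumes lsc: "lsc_strongly_convex_on D \<theta> c"
    and D: "D = {x. \<Theta> x < \<infinity>}" and \<theta>: "\<And>x. x \<in> D \<Longrightarrow> \<Theta> x = ereal (\<theta> x)"
  shows "tilted_min \<Theta> \<xi> \<in> D"
    "\<And>u. u \<in> D \<Longrightarrow> \<theta> (tilted_min \<Theta> \<xi>) + \<xi> \<bullet> (u - tilted_min \<Theta> \<xi>) + c * (norm (u - tilted_min \<Theta> \<xi>))\<^sup>2 \<le> \<theta> u"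
proof -
  define F where "F = (\<lambda>x. \<theta> x + - (\<xi> \<bullet> x))"
  define G where "G = (\<lambda>x. \<Theta> x - ereal (\<xi> \<bullet> x))"
  have F: "lsc_strongly_convex_on D F c" unfolding F_def
    by (rule lsc_strongly_convex_on_add[OF lsc convex_on_linear])
      (use bounded_linear.linear[OF bounded_linear_minus[OF bounded_linear_inner_right]] in blast, intro continuous_intros)
  have G: "G x = ereal (F x)" if "x \<in> D" for x using \<theta>[OF that] by (simp add: G_def F_def)
  have G': "G x = \<infinity>" if "x \<notin> D" for x using that unfolding D G_def by simp
  obtain x where x: "x \<in> D" "\<And>u. u \<in> D \<Longrightarrow> F x \<le> F u" using minimizer_exists[OF F] by blast
  have "G x \<le> G u" for u using x G G' by (cases "u \<in> D") auto
  then have "is_arg_min G (\<lambda>_. True) x" unfolding is_arg_min_def by (simp add: not_less)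
  then have am: "is_arg_min G (\<lambda>_. True) (tilted_min \<Theta> \<xi>)"
    unfolding tilted_min_def arg_min_def G_def[symmetric] by (rule someI)
  then have le: "G (tilted_min \<Theta> \<xi>) \<le> G u" for u unfolding is_arg_min_def by (simp add: not_less)
  show tD: "tilted_min \<Theta> \<xi> \<in> D"
    using le[of x] G[OF x(1)] G'[of "tilted_min \<Theta> \<xi>"] by fastforce
  have "F (tilted_min \<Theta> \<xi>) \<le> F u" if "u \<in> D" for u using le[of u] G[OF that] G[OF tD] by simp
  from minimizer_quadratic_growth[OF F tD this]
  show "\<theta> (tilted_min \<Theta> \<xi>) + \<xi> \<bullet> (u - tilted_min \<Theta> \<xi>) + c * (norm (u - tilted_min \<Theta> \<xi>))\<^sup>2 \<le> \<theta> u" if "u \<in> D" for u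
    using that unfolding F_def by (simp add: inner_diff_right algebra_simps)
qed

section \<open>The iteration as descent in the dual variable\<close>

text \<open>
  Everything that does not depend on the noise, kept apart so that the constants derived from
  it are visibly uniform in \<open>\<delta>\<close>.  The exact data are \<open>A p\<close>, and \<open>G\<close> bounds the gap of
  the starting point, which all runs share.
\<close>

locale dual_setting =
  fixes D :: "'a::{real_inner,complete_space} set" and \<theta> :: "'a \<Rightarrow> real" and c :: real
    and A :: "'a \<Rightarrow> 'b::{real_inner,complete_space}"
    and \<alpha> :: "nat \<Rightarrow> real" and \<tau> \<mu>0 \<mu>1 :: real and \<xi>0 p :: 'a and G :: real
  assumes lsc: "lsc_strongly_convex_on D \<theta> c"
    and A: "bounded_linear A"
    and \<alpha>_pos: "\<And>n. 0 < \<alpha> n" and \<alpha>_dec: "decseq \<alpha>"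
    and \<tau>: "1 < \<tau>" and \<mu>0: "0 < \<mu>0" "\<mu>0 < 4 * c * (1 - 1 / \<tau>)" and \<mu>1: "0 < \<mu>1"
    and pD: "p \<in> D"
    and p_min: "\<And>u. u \<in> D \<Longrightarrow> A u = A p \<Longrightarrow> \<theta> p - \<xi>0 \<bullet> p \<le> \<theta> u - \<xi>0 \<bullet> u"
begin

lemma c_pos: "0 < c" using lsc by (rule lsc_strongly_convex_onD)

lemma \<alpha>_le: "m \<le> n \<Longrightarrow> \<alpha> n \<le> \<alpha> m" using \<alpha>_dec by (simp add: decseq_def)

text \<open>
  Each step before stopping lowers the gap by at least this fraction of \<open>t\<^sub>n q\<^sub>n\<close>: the losses
  are \<open>1 / \<tau>\<close> to the noise and \<open>\<mu>0 / (4 c)\<close> to the step length.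
\<close>

definition \<kappa> :: real where "\<kappa> = 1 - 1 / \<tau> - \<mu>0 / (4 * c)"

text \<open>
  A lower bound for all step sizes, because the quotient in their definition is at least \<open>\<mu>0\<close>.
\<close>

definition tmin :: real where "tmin = min \<mu>0 \<mu>1"

text \<open>
  The bound for the sum of the \<open>q\<^sub>n\<close> before stopping that results from the decrease of the gap.
\<close>

definition Q :: real where "Q = G / (\<kappa> * tmin)"

text \<open>
  The bound for the first \<open>N\<close> dual iterates: before stopping, each of the first \<open>N\<close> steps has
  length at most \<open>\<mu>1 sqrt (Q / \<alpha> N)\<close>.
\<close>

definition W :: "nat \<Rightarrow> real" where "W N = real N * (\<mu>1 * sqrt (Q / \<alpha> N))"

lemma \<kappa>_pos: "0 < \<kappa>"
  using \<mu>0(2) c_pos by (simp add: \<kappa>_def pos_divide_less_eq mult.commute)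

lemma tmin_pos: "0 < tmin" using \<mu>0(1) \<mu>1 by (simp add: tmin_def)

lemma adjoint_simps:
  "adjoint A 0 = 0" "adjoint A (u + w) = adjoint A u + adjoint A w"
  "adjoint A (u - w) = adjoint A u - adjoint A w" "adjoint A (s *\<^sub>R w) = s *\<^sub>R adjoint A w"
  using bounded_linear.linear[OF bounded_linear_adjoint[OF A]]
  by (simp_all add: linear_0 linear_add linear_diff linear_scale)

lemma inner_adjoint_left: "adjoint A w \<bullet> u = w \<bullet> A u"
  using inner_adjoint[OF A, of u w] by (simp add: inner_commute)

lemma A_diff: "A (u - w) = A u - A w"
  using bounded_linear.linear[OF A] by (rule linear_diff)

end

text \<open>
  One run for data \<open>v\<close> of noise level \<open>\<delta>\<close>.  The primal iterates enter only through the growth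
  inequality of a tilted minimizer, the step sizes only through three inequalities.
\<close>

locale noisy_iteration = dual_setting D \<theta> c A \<alpha> \<tau> \<mu>0 \<mu>1 \<xi>0 p G
  for D :: "'a::{real_inner,complete_space} set" and \<theta> :: "'a \<Rightarrow> real" and c :: real
    and A :: "'a \<Rightarrow> 'b::{real_inner,complete_space}"
    and \<alpha> :: "nat \<Rightarrow> real" and \<tau> \<mu>0 \<mu>1 :: real and \<xi>0 p :: 'a and G :: real +
  fixes \<delta> :: real and v :: 'b and x :: "nat \<Rightarrow> 'a" and w z :: "nat \<Rightarrow> 'b" and t :: "nat \<Rightarrow> real"
  assumes \<delta>: "0 < \<delta>" and noise: "norm (v - A p) \<le> \<delta>"
    and xD: "\<And>n. x n \<in> D"
    and growth: "\<And>n u. u \<in> D \<Longrightarrow>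
      \<theta> (x n) + (\<xi>0 - adjoint A (w n)) \<bullet> (u - x n) + c * (norm (u - x n))\<^sup>2 \<le> \<theta> u"
    and w_0: "w 0 = 0" and w_Suc: "\<And>n. w (Suc n) = w n + t n *\<^sub>R z n"
    and z: "\<And>n. \<alpha> n *\<^sub>R z n + A (adjoint A (z n)) = A (x n) - v"
    and t_ge: "\<And>n. min \<mu>0 \<mu>1 \<le> t n" and t_le: "\<And>n. t n \<le> \<mu>1"
    and t_adj: "\<And>n. t n * (norm (adjoint A (z n)))\<^sup>2 \<le> \<mu>0 * (z n \<bullet> (A (x n) - v))"
    and initial_gap: "\<theta> p - \<theta> (x 0) - \<xi>0 \<bullet> (p - x 0) \<le> G"
begin

definition q :: "nat \<Rightarrow> real" where "q n = z n \<bullet> (A (x n) - v)"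

definition gap :: "nat \<Rightarrow> real" where
  "gap n = \<theta> p - \<theta> (x n) - (\<xi>0 - adjoint A (w n)) \<bullet> (p - x n)"

definition running :: "nat \<Rightarrow> bool" where "running n \<longleftrightarrow> (\<forall>i<n. \<tau>\<^sup>2 * \<delta>\<^sup>2 < \<alpha> i * q i)"

lemma t_pos: "0 < t n" using t_ge[of n] tmin_pos unfolding tmin_def by linarith

text \<open>
  Pairing the equation that defines \<open>z\<^sub>n\<close> with \<open>z\<^sub>n\<close> itself.  All estimates on \<open>z\<^sub>n\<close> and \<open>A\<^sup>* z\<^sub>n\<close> come
  from this identity.
\<close>

lemma q_eq: "q n = \<alpha> n * (norm (z n))\<^sup>2 + (norm (adjoint A (z n)))\<^sup>2"
proof -
  have "q n = z n \<bullet> (\<alpha> n *\<^sub>R z n + A (adjoint A (z n)))" by (simp only: q_def z)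
  also have "\<dots> = \<alpha> n * (z n \<bullet> z n) + adjoint A (z n) \<bullet> adjoint A (z n)"
    by (simp add: inner_add_right inner_adjoint_left)
  finally show ?thesis by (simp only: power2_norm_eq_inner)
qed

lemma q_ge: "0 \<le> q n" "\<alpha> n * (norm (z n))\<^sup>2 \<le> q n" "(norm (adjoint A (z n)))\<^sup>2 \<le> q n"
  using \<alpha>_pos[of n] by (simp_all add: q_eq)

lemma norm_z_le: "norm (z n) \<le> sqrt (q n / \<alpha> n)"
  using q_ge(2)[of n] \<alpha>_pos[of n] by (intro real_le_rsqrt) (simp add: field_simps)

lemma norm_sq_le_gap: "c * (norm (p - x n))\<^sup>2 \<le> gap n"
  unfolding gap_def using growth[OF pD, of n] by simp

lemma gap_ge_0: "0 \<le> gap n"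
proof -
  have "0 \<le> c * (norm (p - x n))\<^sup>2" using c_pos by simp
  then show ?thesis using norm_sq_le_gap[of n] by linarith
qed

lemma gap_0_le: "gap 0 \<le> G" unfolding gap_def w_0 adjoint_simps using initial_gap by simp

lemma G_nonneg: "0 \<le> G" using gap_0_le gap_ge_0[of 0] by linarith

lemma Q_nonneg: "0 \<le> Q" unfolding Q_def using G_nonneg \<kappa>_pos tmin_pos by simp

lemma W_nonneg: "0 \<le> W N" unfolding W_def using \<mu>1 Q_nonneg \<alpha>_pos[of N] by simp

text \<open>
  The change of the gap splits into three parts: the growth inequality at \<open>x n\<close>, which contributes
  \<open>- c \<parallel>h\<parallel>\<^sup>2\<close>; a cross term that this square absorbs at the cost \<open>t\<^sup>2 \<parallel>A\<^sup>* z\<parallel>\<^sup>2 / (4 c)\<close>, controlled by the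
  choice of the step size; and the main term \<open>- t q\<close> with its noise error, which is at most \<open>t q / \<tau>\<close>
  because the stopping criterion fails.
\<close>

lemma gap_Suc:
  assumes "\<tau>\<^sup>2 * \<delta>\<^sup>2 < \<alpha> n * q n"
  shows "gap (Suc n) + \<kappa> * (t n * q n) \<le> gap n"
proof -
  define a where "a = adjoint A (z n)"
  define \<xi> where "\<xi> = \<xi>0 - adjoint A (w n)"
  define h where "h = x (Suc n) - x n"
  have \<xi>': "\<xi>0 - adjoint A (w (Suc n)) = \<xi> - t n *\<^sub>R a"
    unfolding w_Suc adjoint_simps \<xi>_def a_def by simp
  have px: "p - x (Suc n) = (p - x n) - h" unfolding h_def by simp
  have "gap (Suc n) - gap n
      = (\<theta> (x n) - \<theta> (x (Suc n)) + \<xi> \<bullet> h) - t n * (a \<bullet> h) + t n * (a \<bullet> (p - x n))"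
    unfolding gap_def \<xi>' \<xi>_def[symmetric] px by (simp add: inner_diff_left inner_diff_right algebra_simps)
  moreover have "\<theta> (x n) - \<theta> (x (Suc n)) + \<xi> \<bullet> h \<le> - c * (norm h)\<^sup>2"
    using growth[OF xD, of n "Suc n"] unfolding \<xi>_def h_def by simp
  moreover have "- t n * (a \<bullet> h) - c * (norm h)\<^sup>2 \<le> t n * (\<mu>0 / (4 * c) * q n)"
  proof -
    have "- (a \<bullet> h) \<le> norm a * norm h" using Cauchy_Schwarz_ineq2[of a h] by linarith
    then have "t n * (- (a \<bullet> h)) \<le> t n * (norm a * norm h)"
      by (rule mult_left_mono) (use t_pos[of n] in simp)
    moreover have "t n * (norm a * norm h) - c * (norm h)\<^sup>2 \<le> (t n)\<^sup>2 * (norm a)\<^sup>2 / (4 * c)"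
    proof -
      have "0 \<le> (t n * norm a - 2 * c * norm h)\<^sup>2" by simp
      then show ?thesis using c_pos by (simp add: field_simps power2_eq_square)
    qed
    moreover have "(t n)\<^sup>2 * (norm a)\<^sup>2 / (4 * c) \<le> t n * (\<mu>0 / (4 * c) * q n)"
    proof -
      have "t n * (t n * (norm a)\<^sup>2) \<le> t n * (\<mu>0 * q n)"
        using t_adj[of n] t_pos[of n] unfolding a_def q_def by simp
      then show ?thesis using c_pos by (simp add: field_simps power2_eq_square)
    qed
    ultimately show ?thesis by linarith
  qed
  moreover have "t n * (a \<bullet> (p - x n)) \<le> t n * (q n / \<tau> - q n)"
  proof -
    have "a \<bullet> (p - x n) = z n \<bullet> (A p - v) - q n"
      unfolding a_def inner_adjoint_left A_diff q_def by (simp add: inner_diff_right)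
    also have "z n \<bullet> (A p - v) \<le> norm (z n) * norm (A p - v)" by (rule norm_cauchy_schwarz)
    also have "\<dots> \<le> norm (z n) * \<delta>" using noise by (intro mult_left_mono) (simp_all add: norm_minus_commute)
    also have "\<dots> \<le> q n / \<tau>"
    proof (rule power2_le_imp_le)
      have "(\<tau> * (norm (z n) * \<delta>))\<^sup>2 = (norm (z n))\<^sup>2 * (\<tau>\<^sup>2 * \<delta>\<^sup>2)" by (simp add: power_mult_distrib)
      also have "\<dots> \<le> (norm (z n))\<^sup>2 * (\<alpha> n * q n)" using assms by (intro mult_left_mono) simp_all
      also have "\<dots> = (\<alpha> n * (norm (z n))\<^sup>2) * q n" by simp
      also have "\<dots> \<le> q n * q n" by (rule mult_right_mono[OF q_ge(2) q_ge(1)])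
      finally show "(norm (z n) * \<delta>)\<^sup>2 \<le> (q n / \<tau>)\<^sup>2"
        using \<tau> by (simp add: field_simps power2_eq_square)
    qed (use q_ge(1)[of n] \<tau> in simp)
    finally have "a \<bullet> (p - x n) \<le> q n / \<tau> - q n" by simp
    then show ?thesis using t_pos[of n] by simp
  qed
  ultimately have "gap (Suc n) - gap n \<le> t n * (\<mu>0 / (4 * c) * q n) + t n * (q n / \<tau> - q n)" by linarith
  also have "\<dots> = - (\<kappa> * (t n * q n))" unfolding \<kappa>_def by (simp add: algebra_simps)
  finally show ?thesis by simp
qed

lemma running_mono: "running n \<Longrightarrow> m \<le> n \<Longrightarrow> running m" unfolding running_def by simp

lemma gap_plus_sum_q_le:
  assumes "running n"
  shows "gap n + \<kappa> * tmin * (\<Sum>i<n. q i) \<le> G"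
  using assms
proof (induction n)
  case 0 then show ?case using gap_0_le by simp
next
  case (Suc n)
  have "\<kappa> * (tmin * q n) \<le> \<kappa> * (t n * q n)"
    using t_ge[of n] q_ge(1)[of n] \<kappa>_pos unfolding tmin_def by (intro mult_left_mono mult_right_mono) auto
  moreover have "gap (Suc n) + \<kappa> * (t n * q n) \<le> gap n"
    using Suc.prems by (intro gap_Suc) (simp add: running_def)
  moreover have "gap n + \<kappa> * tmin * (\<Sum>i<n. q i) \<le> G"
    using Suc.IH running_mono[OF Suc.prems] by simp
  ultimately show ?case by (simp add: algebra_simps)
qed

lemma sum_q_le: "running n \<Longrightarrow> (\<Sum>i<n. q i) \<le> Q"
  unfolding Q_def using gap_plus_sum_q_le[of n] gap_ge_0[of n] \<kappa>_pos tmin_pos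
  by (simp add: pos_le_divide_eq mult.commute)

lemma q_le: "running n \<Longrightarrow> i < n \<Longrightarrow> q i \<le> Q"
  using member_le_sum[of i "{..<n}" q] q_ge(1) sum_q_le[of n] by fastforce

lemma gap_antimono:
  assumes "running n" "m \<le> n"
  shows "gap n \<le> gap m"
  using assms(2,1)
proof (induction n rule: dec_induct)
  case (step n)
  have "gap (Suc n) + \<kappa> * (t n * q n) \<le> gap n"
    using step.prems by (intro gap_Suc) (simp add: running_def)
  moreover have "0 \<le> \<kappa> * (t n * q n)" using \<kappa>_pos t_pos[of n] q_ge(1)[of n] by simp
  ultimately show ?case using step.IH running_mono[OF step.prems] by simp
qed simp

lemma norm_w_le:
  assumes "running n" "n \<le> N"
  shows "norm (w n) \<le> W N"
proof -
  have "norm (w n) \<le> real n * (\<mu>1 * sqrt (Q / \<alpha> N))" using assms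
  proof (induction n)
    case 0 then show ?case by (simp add: w_0)
  next
    case (Suc n)
    have "norm (w (Suc n)) \<le> norm (w n) + t n * norm (z n)"
      unfolding w_Suc using norm_triangle_ineq[of "w n" "t n *\<^sub>R z n"] t_pos[of n] by simp
    also have "\<dots> \<le> real n * (\<mu>1 * sqrt (Q / \<alpha> N)) + \<mu>1 * sqrt (Q / \<alpha> N)"
    proof (intro add_mono mult_mono t_le)
      show "norm (w n) \<le> real n * (\<mu>1 * sqrt (Q / \<alpha> N))"
        using Suc.IH running_mono[OF Suc.prems(1)] Suc.prems(2) by simp
      have "q n / \<alpha> n \<le> Q / \<alpha> N"
        using q_le[OF Suc.prems(1), of n] \<alpha>_le[of n N] \<alpha>_pos[of N] Suc.prems(2) Q_nonneg
        by (intro frac_le) auto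
      then show "norm (z n) \<le> sqrt (Q / \<alpha> N)"
        using norm_z_le[of n] real_sqrt_le_mono order_trans by blast
    qed (use \<mu>1 in simp_all)
    finally show ?case by (simp add: algebra_simps)
  qed
  also have "\<dots> \<le> W N" unfolding W_def
    using assms(2) \<mu>1 Q_nonneg \<alpha>_pos[of N] by (intro mult_right_mono) simp_all
  finally show ?thesis .
qed

text \<open>
  The gradient inequality for the convex gap function, compared between \<open>w n\<close> and an
  arbitrary \<open>w'\<close>.  It is the subgradient inequality at \<open>x'\<close>, tested with \<open>x n\<close>.
\<close>

lemma gap_le_dual_value:
  assumes "subgradient_on D \<theta> (\<xi>0 - adjoint A w') x'"
  shows "gap n + (w n - w') \<bullet> (A (x n) - A p) \<le> \<theta> p - \<theta> x' - (\<xi>0 - adjoint A w') \<bullet> (p - x')"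
proof -
  have "(w n - w') \<bullet> (A (x n) - A p) = (adjoint A (w n) - adjoint A w') \<bullet> (x n - p)"
    unfolding adjoint_simps[symmetric] inner_adjoint_left A_diff ..
  moreover have "\<theta> x' + (\<xi>0 - adjoint A w') \<bullet> (x n - x') \<le> \<theta> (x n)"
    using assms xD[of n] unfolding subgradient_on_def by blast
  ultimately show ?thesis unfolding gap_def
    by (simp add: inner_diff_left inner_diff_right)
qed

text \<open>
  The regret estimate.  One step changes the energy \<open>E n\<close>, the squared distance of \<open>w n\<close> to \<open>w'\<close> in the
  preconditioner metric, by twice \<open>t\<close> times the pairing of \<open>w n - w'\<close> with the noisy residual, plus \<open>t\<^sup>2 q\<close>:
  in this metric the step \<open>z n\<close> represents the residual.  Up to the noise, convexity bounds the pairing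
  by minus the excess of the gap over its value at \<open>w'\<close>.  Since \<open>\<alpha>\<close> decreases, changing the metric from
  \<open>n\<close> to \<open>n + 1\<close> only helps, and the sum telescopes.
\<close>

lemma gap_le_while_running:
  assumes run: "running N"
    and sub: "subgradient_on D \<theta> (\<xi>0 - adjoint A w') x'"
  shows "2 * tmin * real N * (gap N - (\<theta> p - \<theta> x' - (\<xi>0 - adjoint A w') \<bullet> (p - x')))
     \<le> \<alpha> 0 * (norm w')\<^sup>2 + (norm (adjoint A w'))\<^sup>2 + \<mu>1\<^sup>2 * Q + 2 * \<mu>1 * real N * (\<delta> * (W N + norm w'))"
proof -
  define B where "B = \<theta> p - \<theta> x' - (\<xi>0 - adjoint A w') \<bullet> (p - x')"
  define V where "V = \<delta> * (W N + norm w')"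
  define E where "E n = \<alpha> n * (norm (w n - w'))\<^sup>2 + (norm (adjoint A (w n - w')))\<^sup>2" for n
  have V0: "0 \<le> V" unfolding V_def using \<delta> W_nonneg by simp
  have E0: "E 0 = \<alpha> 0 * (norm w')\<^sup>2 + (norm (adjoint A w'))\<^sup>2"
    unfolding E_def w_0 adjoint_simps by simp
  have E_Suc: "E (Suc n) \<le> E n + 2 * t n * ((w n - w') \<bullet> (A (x n) - v)) + (t n)\<^sup>2 * q n" for n
  proof -
    have "E (Suc n) \<le> \<alpha> n * (norm (w (Suc n) - w'))\<^sup>2 + (norm (adjoint A (w (Suc n) - w')))\<^sup>2"
      unfolding E_def using \<alpha>_le[of n "Suc n"] by (intro add_right_mono mult_right_mono) simp_all
    also have "w (Suc n) - w' = (w n - w') + t n *\<^sub>R z n" unfolding w_Suc by simp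
    also have "adjoint A ((w n - w') + t n *\<^sub>R z n) = adjoint A (w n - w') + t n *\<^sub>R adjoint A (z n)"
      by (simp only: adjoint_simps(2,4))
    also have "\<alpha> n * (norm ((w n - w') + t n *\<^sub>R z n))\<^sup>2 + (norm (adjoint A (w n - w') + t n *\<^sub>R adjoint A (z n)))\<^sup>2
      = E n + 2 * t n * (\<alpha> n * ((w n - w') \<bullet> z n) + adjoint A (w n - w') \<bullet> adjoint A (z n)) + (t n)\<^sup>2 * q n"
      unfolding norm_sq_along_line E_def q_eq by (simp add: algebra_simps)
    also have "\<alpha> n * ((w n - w') \<bullet> z n) + adjoint A (w n - w') \<bullet> adjoint A (z n) = (w n - w') \<bullet> (A (x n) - v)"
      unfolding z[symmetric] inner_add_right inner_adjoint_left by simp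
    finally show ?thesis .
  qed
  (* If the gap has already fallen to B there is nothing to show; otherwise, being
     monotone, it has exceeded B by at least gap N - B at every earlier step. *)
  show ?thesis
  proof (cases "gap N \<le> B")
    case True
    then have "2 * tmin * real N * (gap N - B) \<le> 0" using tmin_pos by (simp add: mult_le_0_iff)
    moreover have "0 \<le> \<alpha> 0 * (norm w')\<^sup>2 + (norm (adjoint A w'))\<^sup>2 + \<mu>1\<^sup>2 * Q + 2 * \<mu>1 * real N * V"
      using \<alpha>_pos[of 0] Q_nonneg \<mu>1 V0 by simp
    ultimately show ?thesis unfolding B_def V_def by linarith
  next
    case False
    have step: "E (Suc n) + 2 * tmin * (gap N - B) \<le> E n + \<mu>1\<^sup>2 * q n + 2 * \<mu>1 * V" if n: "n < N" for n
    proof -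
      have "(w n - w') \<bullet> (A (x n) - v) = (w n - w') \<bullet> (A (x n) - A p) + (w n - w') \<bullet> (A p - v)"
        by (simp add: inner_diff_right)
      moreover have "(w n - w') \<bullet> (A (x n) - A p) \<le> - (gap N - B)"
        using gap_le_dual_value[OF sub, of n] gap_antimono[OF run, of n] n unfolding B_def by linarith
      moreover have "(w n - w') \<bullet> (A p - v) \<le> V"
      proof -
        have "(w n - w') \<bullet> (A p - v) \<le> norm (w n - w') * norm (A p - v)" by (rule norm_cauchy_schwarz)
        also have "\<dots> \<le> (W N + norm w') * \<delta>"
        proof (rule mult_mono)
          show "norm (w n - w') \<le> W N + norm w'"
            using norm_triangle_ineq4[of "w n" w'] norm_w_le[OF running_mono[OF run], of n N] n by simp
        qed (use noise W_nonneg in \<open>simp_all add: norm_minus_commute\<close>)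
        finally show ?thesis unfolding V_def by (simp add: mult.commute)
      qed
      ultimately have "(w n - w') \<bullet> (A (x n) - v) \<le> V - (gap N - B)" by linarith
      then have "2 * t n * ((w n - w') \<bullet> (A (x n) - v)) \<le> 2 * t n * (V - (gap N - B))"
        using t_pos[of n] by simp
      moreover have "tmin * (gap N - B) \<le> t n * (gap N - B)"
        using False t_ge[of n] unfolding tmin_def by (intro mult_right_mono) simp_all
      moreover have "t n * V \<le> \<mu>1 * V" using t_le V0 by (intro mult_right_mono)
      moreover have "(t n)\<^sup>2 * q n \<le> \<mu>1\<^sup>2 * q n"
        using t_le[of n] t_pos[of n] q_ge(1)[of n] by (intro mult_right_mono power_mono) simp_all
      ultimately show ?thesis using E_Suc[of n] by (simp add: algebra_simps)
    qed
    have "E n + 2 * tmin * real n * (gap N - B) \<le> E 0 + \<mu>1\<^sup>2 * (\<Sum>i<n. q i) + 2 * \<mu>1 * real n * V"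
      if "n \<le> N" for n
      using that
    proof (induction n)
      case (Suc n)
      then show ?case using step[of n] by (simp add: algebra_simps)
    qed simp
    from this[of N] have "E N + 2 * tmin * real N * (gap N - B) \<le> E 0 + \<mu>1\<^sup>2 * (\<Sum>i<N. q i) + 2 * \<mu>1 * real N * V"
      by simp
    moreover have "\<mu>1\<^sup>2 * (\<Sum>i<N. q i) \<le> \<mu>1\<^sup>2 * Q" using sum_q_le[OF run] by (intro mult_left_mono) simp_all
    moreover have "0 \<le> E N" unfolding E_def using \<alpha>_pos[of N] by simp
    ultimately show ?thesis unfolding E0 B_def V_def by linarith
  qed
qed

text \<open>
  At the stopping index \<open>q m\<close> is of order \<open>\<delta>\<^sup>2\<close>, and the residual is bounded by a multiple of the square
  root of \<open>q m\<close> through the equation for \<open>z m\<close>; the gradient inequality does the rest.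
\<close>

lemma gap_le_if_stopped_early:
  assumes run: "running m" and stop: "\<alpha> m * q m \<le> \<tau>\<^sup>2 * \<delta>\<^sup>2" and m: "m \<le> N"
    and sub: "subgradient_on D \<theta> (\<xi>0 - adjoint A w') x'"
    and K: "\<And>u. norm (A u) \<le> norm u * K" "0 \<le> K"
  shows "gap m \<le> (\<theta> p - \<theta> x' - (\<xi>0 - adjoint A w') \<bullet> (p - x'))
     + (W N + norm w') * (((sqrt (\<alpha> 0) + K) * (\<tau> / sqrt (\<alpha> N)) + 1) * \<delta>)"
proof -
  have "\<alpha> N * q m \<le> \<alpha> m * q m" using \<alpha>_le[OF m] q_ge(1) by (rule mult_right_mono)
  then have "q m \<le> \<tau>\<^sup>2 * \<delta>\<^sup>2 / \<alpha> N" using stop \<alpha>_pos[of N] by (simp add: pos_le_divide_eq mult.commute)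
  then have "sqrt (q m) \<le> sqrt (\<tau>\<^sup>2 * \<delta>\<^sup>2 / \<alpha> N)" by (rule real_sqrt_le_mono)
  also have "\<dots> = \<tau> / sqrt (\<alpha> N) * \<delta>"
    using \<tau> \<delta> by (simp add: real_sqrt_divide real_sqrt_mult)
  finally have sq: "sqrt (q m) \<le> \<tau> / sqrt (\<alpha> N) * \<delta>" .
  have "norm (A (x m) - A p) \<le> norm (A (x m) - v) + norm (v - A p)"
    using norm_triangle_ineq[of "A (x m) - v" "v - A p"] by simp
  also have "norm (A (x m) - v) \<le> \<alpha> m * norm (z m) + norm (A (adjoint A (z m)))"
    unfolding z[symmetric] using norm_triangle_ineq[of "\<alpha> m *\<^sub>R z m"] \<alpha>_pos[of m] by simp
  also have "\<alpha> m * norm (z m) \<le> sqrt (\<alpha> 0) * sqrt (q m)"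
  proof -
    have "(\<alpha> m * norm (z m))\<^sup>2 = \<alpha> m * (\<alpha> m * (norm (z m))\<^sup>2)" by (simp add: power2_eq_square)
    also have "\<dots> \<le> \<alpha> 0 * q m"
      using \<alpha>_le[of 0 m] \<alpha>_pos[of m] \<alpha>_pos[of 0] q_ge(2)[of m] by (intro mult_mono) simp_all
    finally have "\<alpha> m * norm (z m) \<le> sqrt (\<alpha> 0 * q m)" by (rule real_le_rsqrt)
    then show ?thesis by (simp add: real_sqrt_mult)
  qed
  also have "norm (A (adjoint A (z m))) \<le> sqrt (q m) * K"
  proof -
    have "norm (adjoint A (z m)) \<le> sqrt (q m)" using q_ge(3) by (rule real_le_rsqrt)
    then show ?thesis using K(1)[of "adjoint A (z m)"] mult_right_mono[OF _ K(2)] order_trans by blast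
  qed
  also have "norm (v - A p) \<le> \<delta>" by (rule noise)
  finally have "norm (A (x m) - A p) \<le> (sqrt (\<alpha> 0) + K) * sqrt (q m) + \<delta>" by (simp add: algebra_simps)
  also have "\<dots> \<le> (sqrt (\<alpha> 0) + K) * (\<tau> / sqrt (\<alpha> N) * \<delta>) + \<delta>"
    using sq \<alpha>_pos[of 0] K(2) by (intro add_right_mono mult_left_mono) simp_all
  also have "\<dots> = ((sqrt (\<alpha> 0) + K) * (\<tau> / sqrt (\<alpha> N)) + 1) * \<delta>" by (simp add: algebra_simps)
  finally have res: "norm (A (x m) - A p) \<le> ((sqrt (\<alpha> 0) + K) * (\<tau> / sqrt (\<alpha> N)) + 1) * \<delta>" .
  have "- ((w m - w') \<bullet> (A (x m) - A p)) \<le> norm (w m - w') * norm (A (x m) - A p)"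
    using Cauchy_Schwarz_ineq2[of "w m - w'" "A (x m) - A p"] by linarith
  also have "\<dots> \<le> (W N + norm w') * (((sqrt (\<alpha> 0) + K) * (\<tau> / sqrt (\<alpha> N)) + 1) * \<delta>)"
  proof (rule mult_mono[OF _ res])
    show "norm (w m - w') \<le> W N + norm w'"
      using norm_triangle_ineq4[of "w m" w'] norm_w_le[OF run m] by simp
  qed (use W_nonneg in simp_all)
  finally show ?thesis using gap_le_dual_value[OF sub, of m] by linarith
qed

text \<open>
  A run that never stops would keep \<open>q\<close> above \<open>\<tau>\<^sup>2 \<delta>\<^sup>2 / \<alpha> 0\<close>, against the boundedness of its sums.
\<close>

lemma stops: "\<exists>m. \<alpha> m * q m \<le> \<tau>\<^sup>2 * \<delta>\<^sup>2"
proof (rule ccontr)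
  assume "\<nexists>m. \<alpha> m * q m \<le> \<tau>\<^sup>2 * \<delta>\<^sup>2"
  then have all: "\<tau>\<^sup>2 * \<delta>\<^sup>2 < \<alpha> i * q i" for i by (simp add: not_le)
  define b where "b = \<tau>\<^sup>2 * \<delta>\<^sup>2 / \<alpha> 0"
  have b: "0 < b" unfolding b_def using \<tau> \<delta> \<alpha>_pos[of 0] by simp
  have "b \<le> q i" for i
  proof -
    have "\<alpha> i * q i \<le> \<alpha> 0 * q i" using \<alpha>_le[of 0 i] q_ge(1)[of i] by (simp add: mult_right_mono)
    then show ?thesis unfolding b_def using all[of i] \<alpha>_pos[of 0] by (simp add: pos_divide_le_eq mult.commute)
  qed
  then have "real n * b \<le> (\<Sum>i<n. q i)" for n using sum_bounded_below[of "{..<n}" b q] by simp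
  moreover have "(\<Sum>i<n. q i) \<le> Q" for n using sum_q_le all unfolding running_def by blast
  ultimately have "real n * b \<le> Q" for n using order_trans by blast
  then show False using reals_Archimedean3[OF b] by (meson not_le)
qed

end

section \<open>Convergence at the stopping index\<close>

text \<open>
  The order of choices matters: \<open>w'\<close> with a small gap comes first, then \<open>N\<close> so large that the regret of \<open>w'\<close>
  is small on average, and only then the noise threshold, which may depend on both.  The
  threshold serves all runs at once, so the stopping index may vary arbitrarily with \<open>\<delta>\<close>.
\<close>

lemma (in dual_setting) gap_at_stopping_small:
  assumes "e > 0"
  shows "\<exists>d>0. \<forall>\<delta> v x w z t m. \<delta> < d \<longrightarrow>
     noisy_iteration D \<theta> c A \<alpha> \<tau> \<mu>0 \<mu>1 \<xi>0 p G \<delta> v x w z t \<longrightarrow>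
     (\<forall>i<m. \<tau>\<^sup>2 * \<delta>\<^sup>2 < \<alpha> i * (z i \<bullet> (A (x i) - v))) \<longrightarrow>
     \<alpha> m * (z m \<bullet> (A (x m) - v)) \<le> \<tau>\<^sup>2 * \<delta>\<^sup>2 \<longrightarrow>
     \<theta> p - \<theta> (x m) - (\<xi>0 - adjoint A (w m)) \<bullet> (p - x m) < e"
proof -
  obtain w' x' where sub: "subgradient_on D \<theta> (\<xi>0 - adjoint A w') x'"
    and small: "\<theta> p - \<theta> x' - (\<xi>0 - adjoint A w') \<bullet> (p - x') \<le> e / 4"
    using zero_duality_gap[OF lsc A pD refl p_min, of "e / 4"] assms by auto
  obtain K where K: "\<And>u. norm (A u) \<le> norm u * K" "0 \<le> K"
    using bounded_linear.nonneg_bounded[OF A] by blast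
  define B where "B = \<theta> p - \<theta> x' - (\<xi>0 - adjoint A w') \<bullet> (p - x')"
  define C where "C = (\<alpha> 0 * (norm w')\<^sup>2 + (norm (adjoint A w'))\<^sup>2 + \<mu>1\<^sup>2 * Q) / (2 * tmin)"
  obtain N0 :: nat where N0: "C < real N0 * (e / 4)" using reals_Archimedean3[of "e / 4"] assms by auto
  define N where "N = Suc N0"
  have N: "0 < real N" "C \<le> real N * (e / 4)" using N0 assms by (auto simp: N_def algebra_simps)
  define S1 where "S1 = \<mu>1 / tmin * (W N + norm w')"
  define S2 where "S2 = (W N + norm w') * ((sqrt (\<alpha> 0) + K) * (\<tau> / sqrt (\<alpha> N)) + 1)"
  define S where "S = \<bar>S1\<bar> + \<bar>S2\<bar> + 1"
  have S: "0 < S" "S1 \<le> S" "S2 \<le> S" unfolding S_def by linarith+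
  show ?thesis
  proof (intro exI[of _ "e / (4 * S)"] conjI allI impI)
    show "0 < e / (4 * S)" using assms S by simp
    fix \<delta> v x w z t m
    assume d: "\<delta> < e / (4 * S)"
      and it: "noisy_iteration D \<theta> c A \<alpha> \<tau> \<mu>0 \<mu>1 \<xi>0 p G \<delta> v x w z t"
      and run: "\<forall>i<m. \<tau>\<^sup>2 * \<delta>\<^sup>2 < \<alpha> i * (z i \<bullet> (A (x i) - v))"
      and stop: "\<alpha> m * (z m \<bullet> (A (x m) - v)) \<le> \<tau>\<^sup>2 * \<delta>\<^sup>2"
    interpret noisy_iteration D \<theta> c A \<alpha> \<tau> \<mu>0 \<mu>1 \<xi>0 p G \<delta> v x w z t by (rule it)
    have run: "running m" using run unfolding running_def q_def .
    have dS: "S * \<delta> < e / 4" using d S(1) by (simp add: field_simps)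
    have "gap m < e"
    proof (cases "N \<le> m")
      case True
      have "2 * tmin * real N * (gap N - B)
         \<le> \<alpha> 0 * (norm w')\<^sup>2 + (norm (adjoint A w'))\<^sup>2 + \<mu>1\<^sup>2 * Q + 2 * \<mu>1 * real N * (\<delta> * (W N + norm w'))"
        unfolding B_def by (rule gap_le_while_running[OF running_mono[OF run True] sub])
      also have "\<dots> = 2 * tmin * (C + real N * (S1 * \<delta>))"
        unfolding C_def S1_def using tmin_pos by (simp add: field_simps)
      finally have "2 * tmin * (real N * (gap N - B)) \<le> 2 * tmin * (C + real N * (S1 * \<delta>))" by (simp add: mult.assoc)
      then have "real N * (gap N - B) \<le> C + real N * (S1 * \<delta>)" using tmin_pos by simp
      also have "\<dots> \<le> real N * (e / 4 + S1 * \<delta>)" using N(2) by (simp add: algebra_simps)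
      finally have "gap N - B \<le> e / 4 + S1 * \<delta>" using N(1) by simp
      moreover have "S1 * \<delta> \<le> S * \<delta>" using S(2) \<delta> by (simp add: mult_right_mono)
      ultimately show ?thesis using dS small gap_antimono[OF run True] assms unfolding B_def by linarith
    next
      case False
      have "gap m \<le> B + S2 * \<delta>"
        using gap_le_if_stopped_early[OF run _ _ sub K, of N] stop False unfolding B_def S2_def q_def
        by (simp add: mult.assoc)
      moreover have "S2 * \<delta> \<le> S * \<delta>" using S(3) \<delta> by (simp add: mult_right_mono)
      ultimately show ?thesis using dS small assms unfolding B_def by linarith
    qed
    then show "\<theta> p - \<theta> (x m) - (\<xi>0 - adjoint A (w m)) \<bullet> (p - x m) < e" unfolding gap_def .
  qed
qed

text \<open>
  The lower bound and the last inequality rest on \<open>\<parallel>A\<^sup>* z\<parallel>\<^sup>2 \<le> z \<bullet> r\<close> for \<open>z = (a I + A A\<^sup>*)\<^sup>-\<^sup>1 r\<close>: the quotient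
  in the step size is never below \<open>\<mu>0\<close>.
\<close>

lemma step_size_bounds:
  fixes A :: "'a::{real_inner,complete_space} \<Rightarrow> 'b::{real_inner,complete_space}"
  assumes A: "bounded_linear A" and "0 < a" "0 < \<mu>0" "0 < \<mu>1"
  shows "min \<mu>0 \<mu>1 \<le> step_size A \<mu>0 \<mu>1 a r" "step_size A \<mu>0 \<mu>1 a r \<le> \<mu>1"
    "step_size A \<mu>0 \<mu>1 a r * (norm (adjoint A (reg_inv A a r)))\<^sup>2 \<le> \<mu>0 * (reg_inv A a r \<bullet> r)"
proof -
  define z where "z = reg_inv A a r"
  define g where "g = (norm (adjoint A z))\<^sup>2"
  have "z \<bullet> r = z \<bullet> (a *\<^sub>R z + A (adjoint A z))" unfolding z_def reg_inv_solves[OF A assms(2)] ..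
  also have "\<dots> = a * (z \<bullet> z) + g"
    unfolding g_def power2_norm_eq_inner inner_add_right
    by (simp add: inner_commute[of z "A _"] inner_adjoint[OF A])
  finally have g: "g \<le> z \<bullet> r" using assms(2) by simp
  have g0: "0 \<le> g" unfolding g_def by simp
  have step: "step_size A \<mu>0 \<mu>1 a r = (if g = 0 then \<mu>1 else min (\<mu>0 * (z \<bullet> r) / g) \<mu>1)"
    unfolding step_size_def z_def[symmetric] g_def by simp
  show "step_size A \<mu>0 \<mu>1 a r \<le> \<mu>1" unfolding step by simp
  have "\<mu>0 \<le> \<mu>0 * (z \<bullet> r) / g" if "g \<noteq> 0"
    using g g0 that assms(3) by (simp add: field_simps)
  then show "min \<mu>0 \<mu>1 \<le> step_size A \<mu>0 \<mu>1 a r" unfolding step by (auto simp: min_def)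
  have "min (\<mu>0 * (z \<bullet> r) / g) \<mu>1 * g \<le> \<mu>0 * (z \<bullet> r)" if "g \<noteq> 0"
  proof -
    have "min (\<mu>0 * (z \<bullet> r) / g) \<mu>1 * g \<le> \<mu>0 * (z \<bullet> r) / g * g" using g0 by (intro mult_right_mono) simp_all
    then show ?thesis using that by simp
  qed
  then show "step_size A \<mu>0 \<mu>1 a r * (norm (adjoint A (reg_inv A a r)))\<^sup>2 \<le> \<mu>0 * (reg_inv A a r \<bullet> r)"
    unfolding step z_def[symmetric] g_def[symmetric] using g g0 assms(3) by auto
qed

lemma xi_iter_eq_dual_sum:
  fixes A :: "'a::{real_inner,complete_space} \<Rightarrow> 'b::{real_inner,complete_space}"
    and \<Theta> :: "'a \<Rightarrow> ereal" and \<alpha> :: "nat \<Rightarrow> real" and \<mu>0 \<mu>1 :: real and \<xi>0 :: 'a and v :: 'b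
  assumes A: "bounded_linear A"
  defines "r \<equiv> \<lambda>n. A (x_iter \<Theta> A \<alpha> \<mu>0 \<mu>1 \<xi>0 v n) - v"
  shows "xi_iter \<Theta> A \<alpha> \<mu>0 \<mu>1 \<xi>0 v n
    = \<xi>0 - adjoint A (\<Sum>i<n. step_size A \<mu>0 \<mu>1 (\<alpha> i) (r i) *\<^sub>R reg_inv A (\<alpha> i) (r i))"
proof (induction n)
  case 0
  show ?case using linear_0[OF bounded_linear.linear[OF bounded_linear_adjoint[OF A]]] by simp
next
  case (Suc n)
  note lin = bounded_linear.linear[OF bounded_linear_adjoint[OF A]]
  have "xi_iter \<Theta> A \<alpha> \<mu>0 \<mu>1 \<xi>0 v (Suc n) = xi_iter \<Theta> A \<alpha> \<mu>0 \<mu>1 \<xi>0 v n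
      - step_size A \<mu>0 \<mu>1 (\<alpha> n) (r n) *\<^sub>R adjoint A (reg_inv A (\<alpha> n) (r n))"
    by (simp add: Let_def r_def x_iter_def)
  also have "\<dots> = \<xi>0 - adjoint A (\<Sum>i<Suc n. step_size A \<mu>0 \<mu>1 (\<alpha> i) (r i) *\<^sub>R reg_inv A (\<alpha> i) (r i))"
    unfolding Suc.IH by (simp add: linear_add[OF lin] linear_scale[OF lin])
  finally show ?case .
qed

text \<open>
  On the domain the Bregman distance to the starting point differs from \<open>\<theta> u - \<xi> \<bullet> u\<close> by a constant,
  and outside it is infinite.  Strong convexity on the closed affine solution set makes the
  minimizer exist and be unique, so the definite description denotes it.
\<close>

lemma min_solution_characterization:
  fixes \<Theta> :: "'a::{real_inner,complete_space} \<Rightarrow> ereal" and A :: "'a \<Rightarrow> 'b::real_inner"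
    and \<xi> :: 'a and y :: 'b
  assumes lsc: "lsc_strongly_convex_on D \<theta> c"
    and D: "D = {x. \<Theta> x < \<infinity>}" and \<theta>: "\<And>x. x \<in> D \<Longrightarrow> \<Theta> x = ereal (\<theta> x)"
    and A: "bounded_linear A" and sol: "\<exists>x\<in>D. A x = y"
    and x0: "tilted_min \<Theta> \<xi> \<in> D"
  defines "p \<equiv> min_solution \<Theta> A \<xi> y"
  shows "p \<in> D" "A p = y" "\<And>u. u \<in> D \<Longrightarrow> A u = y \<Longrightarrow> \<theta> p - \<xi> \<bullet> p \<le> \<theta> u - \<xi> \<bullet> u"
proof -
  have lin: "linear A" using A by (rule bounded_linear.linear)
  define S where "S = {x. A x = y}"
  have S: "closed S" "convex S" unfolding S_def
  proof -
    show "closed {x. A x = y}"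
      by (intro closed_Collect_eq linear_continuous_on[OF A] continuous_intros)
    show "convex {x. A x = y}"
      by (rule convexI) (simp add: linear_add[OF lin] linear_scale[OF lin] scaleR_left_distrib[symmetric])
  qed
  have "lsc_strongly_convex_on (D \<inter> S) \<theta> c"
    by (rule lsc_strongly_convex_on_Int[OF lsc S]) (use sol in \<open>auto simp: S_def\<close>)
  then have F: "lsc_strongly_convex_on (D \<inter> S) (\<lambda>x. \<theta> x + - (\<xi> \<bullet> x)) c"
    by (rule lsc_strongly_convex_on_add[OF _ convex_on_linear])
      (use bounded_linear.linear[OF bounded_linear_minus[OF bounded_linear_inner_right]] in blast, intro continuous_intros)
  obtain m where m: "m \<in> D \<inter> S" "\<And>u. u \<in> D \<inter> S \<Longrightarrow> \<theta> m + - (\<xi> \<bullet> m) \<le> \<theta> u + - (\<xi> \<bullet> u)"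
    using minimizer_exists[OF F] by blast
  define b where "b u = bregman \<Theta> \<xi> u (tilted_min \<Theta> \<xi>)" for u
  have b: "b u = ereal (\<theta> u - \<xi> \<bullet> u + (\<xi> \<bullet> tilted_min \<Theta> \<xi> - \<theta> (tilted_min \<Theta> \<xi>)))" if "u \<in> D" for u
    unfolding b_def bregman_def \<theta>[OF that] \<theta>[OF x0] by (simp add: inner_diff_right)
  have b_inf: "b u = \<infinity>" if "u \<notin> D" for u
    using that unfolding b_def bregman_def \<theta>[OF x0] by (simp add: D)
  have "p = m"
    unfolding p_def min_solution_def b_def[symmetric]
  proof (rule the_equality)
    have "b m \<le> b u" if "A u = y" for u
    proof (cases "u \<in> D")
      case True
      then show ?thesis using m(2)[of u] m(1) that b by (simp add: S_def)
    qed (simp add: b_inf)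
    then show "A m = y \<and> \<Theta> m < \<infinity> \<and> (\<forall>x'. A x' = y \<longrightarrow> b m \<le> b x')"
      using m(1) D S_def by simp
    fix u assume u: "A u = y \<and> \<Theta> u < \<infinity> \<and> (\<forall>x'. A x' = y \<longrightarrow> b u \<le> b x')"
    then have uD: "u \<in> D" "u \<in> S" using D S_def by auto
    have mD: "m \<in> D" "A m = y" using m(1) S_def by auto
    have "b u \<le> b m" using u mD(2) by blast
    then have "\<theta> u - \<xi> \<bullet> u \<le> \<theta> m - \<xi> \<bullet> m" unfolding b[OF uD(1)] b[OF mD(1)] by simp
    moreover have "\<theta> m + - (\<xi> \<bullet> m) + c * (norm (u - m))\<^sup>2 \<le> \<theta> u + - (\<xi> \<bullet> u)"
      using minimizer_quadratic_growth[OF F m(1) m(2)] uD by blast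
    ultimately have "c * (norm (u - m))\<^sup>2 \<le> 0" by linarith
    then show "u = m" using lsc_strongly_convex_onD(2)[OF lsc] by (simp add: mult_le_0_iff)
  qed
  then show "p \<in> D" "A p = y" "\<And>u. u \<in> D \<Longrightarrow> A u = y \<Longrightarrow> \<theta> p - \<xi> \<bullet> p \<le> \<theta> u - \<xi> \<bullet> u"
    using m by (auto simp: S_def)
qed

theorem theorem2p6:
  fixes \<Theta> :: "'a::{real_inner,complete_space} \<Rightarrow> ereal"
    and A :: "'a \<Rightarrow> 'b::{real_inner,complete_space}"
    and y :: 'b and y\<delta> :: "real \<Rightarrow> 'b"
    and \<alpha> :: "nat \<Rightarrow> real" and c0 \<tau> \<mu>0 \<mu>1 :: real and \<xi>0 :: 'a
  assumes "proper \<Theta>" and "lower_semicontinuous \<Theta>"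
    and "c0 > 0" and "strongly_convex c0 \<Theta>"
    and "bounded_linear A"
    and "\<exists>x. A x = y \<and> \<Theta> x < \<infinity>"
    and "\<And>n. \<alpha> n > 0" and "decseq \<alpha>"
    and "\<tau> > 1" and "0 < \<mu>0" and "\<mu>0 < 4 * c0 * (1 - 1 / \<tau>)" and "\<mu>1 > 0"
    and "\<And>\<delta>. \<delta> > 0 \<Longrightarrow> norm (y\<delta> \<delta> - y) \<le> \<delta>"
  defines "xdag \<equiv> min_solution \<Theta> A \<xi>0 y"
    and "n\<delta> \<equiv> \<lambda>\<delta>. stop_index \<Theta> A \<alpha> \<mu>0 \<mu>1 \<xi>0 \<tau> \<delta> (y\<delta> \<delta>)"
    and "x\<delta> \<equiv> \<lambda>\<delta>. x_iter \<Theta> A \<alpha> \<mu>0 \<mu>1 \<xi>0 (y\<delta> \<delta>)"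
    and "\<xi>\<delta> \<equiv> \<lambda>\<delta>. xi_iter \<Theta> A \<alpha> \<mu>0 \<mu>1 \<xi>0 (y\<delta> \<delta>)"
  shows "((\<lambda>\<delta>. norm (x\<delta> \<delta> (n\<delta> \<delta>) - xdag)) \<longlongrightarrow> 0) (at_right 0) \<and>
         ((\<lambda>\<delta>. bregman \<Theta> (\<xi>\<delta> \<delta> (n\<delta> \<delta>)) xdag (x\<delta> \<delta> (n\<delta> \<delta>))) \<longlongrightarrow> 0) (at_right 0)"
proof -
  define D where "D = {x. \<Theta> x < \<infinity>}"
  define \<theta> where "\<theta> = (\<lambda>x. real_of_ereal (\<Theta> x))"
  have \<theta>: "\<Theta> x = ereal (\<theta> x)" if "x \<in> D" for x
    using that assms(1) unfolding D_def \<theta>_def proper_def by (cases "\<Theta> x") auto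
  have lsc: "lsc_strongly_convex_on D \<theta> c0"
    unfolding D_def \<theta>_def by (rule lsc_strongly_convex_on_real_part[OF assms(1-4)])
  have tilted: "tilted_min \<Theta> \<xi> \<in> D"
    "u \<in> D \<Longrightarrow> \<theta> (tilted_min \<Theta> \<xi>) + \<xi> \<bullet> (u - tilted_min \<Theta> \<xi>) + c0 * (norm (u - tilted_min \<Theta> \<xi>))\<^sup>2 \<le> \<theta> u"
    for \<xi> u
    by (rule tilted_min_quadratic_growth[OF lsc D_def \<theta>]; assumption)+
  have sol: "\<exists>x\<in>D. A x = y" using assms(6) unfolding D_def by blast
  note dag = min_solution_characterization[OF lsc D_def \<theta> assms(5) sol tilted(1), where \<xi> = \<xi>0, folded xdag_def]
  have pD: "xdag \<in> D" and Ap: "A xdag = y"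
    and pmin: "\<And>u. u \<in> D \<Longrightarrow> A u = y \<Longrightarrow> \<theta> xdag - \<xi>0 \<bullet> xdag \<le> \<theta> u - \<xi>0 \<bullet> u"
    using dag by simp_all
  define G where "G = \<theta> xdag - \<theta> (tilted_min \<Theta> \<xi>0) - \<xi>0 \<bullet> (xdag - tilted_min \<Theta> \<xi>0)"
  have setting: "dual_setting D \<theta> c0 A \<alpha> \<tau> \<mu>0 \<mu>1 \<xi>0 xdag"
    by (rule dual_setting.intro[OF lsc assms(5,7-12) pD]) (simp add: Ap pmin)
  define r where "r = (\<lambda>\<delta> n. A (x\<delta> \<delta> n) - y\<delta> \<delta>)"
  define t where "t = (\<lambda>\<delta> n. step_size A \<mu>0 \<mu>1 (\<alpha> n) (r \<delta> n))"
  define z where "z = (\<lambda>\<delta> n. reg_inv A (\<alpha> n) (r \<delta> n))"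
  define w where "w = (\<lambda>\<delta> n. \<Sum>i<n. t \<delta> i *\<^sub>R z \<delta> i)"
  have \<xi>: "\<xi>\<delta> \<delta> n = \<xi>0 - adjoint A (w \<delta> n)" for \<delta> n
    unfolding \<xi>\<delta>_def w_def t_def z_def r_def x\<delta>_def by (rule xi_iter_eq_dual_sum[OF assms(5)])
  have x: "x\<delta> \<delta> n = tilted_min \<Theta> (\<xi>\<delta> \<delta> n)" for \<delta> n unfolding x\<delta>_def \<xi>\<delta>_def x_iter_def ..
  have it: "noisy_iteration D \<theta> c0 A \<alpha> \<tau> \<mu>0 \<mu>1 \<xi>0 xdag G \<delta> (y\<delta> \<delta>) (x\<delta> \<delta>) (w \<delta>) (z \<delta>) (t \<delta>)"
    if "0 < \<delta>" for \<delta>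
  proof (rule noisy_iteration.intro[OF setting noisy_iteration_axioms.intro])
    show "norm (y\<delta> \<delta> - A xdag) \<le> \<delta>" unfolding Ap by (rule assms(13)[OF that])
    show "x\<delta> \<delta> n \<in> D" for n unfolding x by (rule tilted(1))
    show "\<theta> (x\<delta> \<delta> n) + (\<xi>0 - adjoint A (w \<delta> n)) \<bullet> (u - x\<delta> \<delta> n) + c0 * (norm (u - x\<delta> \<delta> n))\<^sup>2 \<le> \<theta> u"
      if "u \<in> D" for n u unfolding x \<xi>[symmetric] by (rule tilted(2)[OF that])
    show "\<alpha> n *\<^sub>R z \<delta> n + A (adjoint A (z \<delta> n)) = A (x\<delta> \<delta> n) - y\<delta> \<delta>" for n
      unfolding z_def reg_inv_solves[OF assms(5,7)] r_def ..
    note step = step_size_bounds[OF assms(5,7,10,12)]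
    show "min \<mu>0 \<mu>1 \<le> t \<delta> n" "t \<delta> n \<le> \<mu>1" for n unfolding t_def by (rule step)+
    show "t \<delta> n * (norm (adjoint A (z \<delta> n)))\<^sup>2 \<le> \<mu>0 * (z \<delta> n \<bullet> (A (x\<delta> \<delta> n) - y\<delta> \<delta>))" for n
      using step(3)[of n "r \<delta> n"] unfolding t_def z_def by (simp add: r_def)
    show "\<theta> xdag - \<theta> (x\<delta> \<delta> 0) - \<xi>0 \<bullet> (xdag - x\<delta> \<delta> 0) \<le> G"
      unfolding G_def x \<xi>\<delta>_def by simp
  qed (simp_all add: that w_def)
  define g where "g = (\<lambda>\<delta>. \<theta> xdag - \<theta> (x\<delta> \<delta> (n\<delta> \<delta>)) - \<xi>\<delta> \<delta> (n\<delta> \<delta>) \<bullet> (xdag - x\<delta> \<delta> (n\<delta> \<delta>)))"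
  have breg: "bregman \<Theta> (\<xi>\<delta> \<delta> (n\<delta> \<delta>)) xdag (x\<delta> \<delta> (n\<delta> \<delta>)) = ereal (g \<delta>)" for \<delta>
    unfolding bregman_def g_def x using \<theta>[OF pD] \<theta>[OF tilted(1)] by simp
  have g_ge: "c0 * (norm (x\<delta> \<delta> (n\<delta> \<delta>) - xdag))\<^sup>2 \<le> g \<delta>" for \<delta>
    using tilted(2)[OF pD, of "\<xi>\<delta> \<delta> (n\<delta> \<delta>)"] unfolding g_def x by (simp add: norm_minus_commute)
  have stop: "\<alpha> (n\<delta> \<delta>) * (z \<delta> (n\<delta> \<delta>) \<bullet> r \<delta> (n\<delta> \<delta>)) \<le> \<tau>\<^sup>2 * \<delta>\<^sup>2"
    "\<And>i. i < n\<delta> \<delta> \<Longrightarrow> \<tau>\<^sup>2 * \<delta>\<^sup>2 < \<alpha> i * (z \<delta> i \<bullet> r \<delta> i)" if "0 < \<delta>" for \<delta>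
  proof -
    have n: "n\<delta> \<delta> = (LEAST n. \<alpha> n * (z \<delta> n \<bullet> r \<delta> n) \<le> \<tau>\<^sup>2 * \<delta>\<^sup>2)"
      unfolding n\<delta>_def stop_index_def z_def r_def x\<delta>_def Let_def ..
    interpret noisy_iteration D \<theta> c0 A \<alpha> \<tau> \<mu>0 \<mu>1 \<xi>0 xdag G \<delta> "y\<delta> \<delta>" "x\<delta> \<delta>" "w \<delta>" "z \<delta>" "t \<delta>"
      by (rule it[OF that])
    have "\<exists>n. \<alpha> n * (z \<delta> n \<bullet> r \<delta> n) \<le> \<tau>\<^sup>2 * \<delta>\<^sup>2" using stops unfolding q_def r_def .
    then show "\<alpha> (n\<delta> \<delta>) * (z \<delta> (n\<delta> \<delta>) \<bullet> r \<delta> (n\<delta> \<delta>)) \<le> \<tau>\<^sup>2 * \<delta>\<^sup>2" unfolding n by (rule LeastI_ex)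
    show "\<tau>\<^sup>2 * \<delta>\<^sup>2 < \<alpha> i * (z \<delta> i \<bullet> r \<delta> i)" if "i < n\<delta> \<delta>" for i
      using not_less_Least[OF that[unfolded n]] by simp
  qed
  have g_tendsto: "(g \<longlongrightarrow> 0) (at_right 0)"
  proof (rule tendstoI)
    fix e :: real assume "e > 0"
    from dual_setting.gap_at_stopping_small[OF setting this, of G] obtain d where d: "d > 0"
      and small: "\<And>\<delta> v x w z t m. \<delta> < d \<Longrightarrow>
        noisy_iteration D \<theta> c0 A \<alpha> \<tau> \<mu>0 \<mu>1 \<xi>0 xdag G \<delta> v x w z t \<Longrightarrow>
        \<forall>i<m. \<tau>\<^sup>2 * \<delta>\<^sup>2 < \<alpha> i * (z i \<bullet> (A (x i) - v)) \<Longrightarrow>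
        \<alpha> m * (z m \<bullet> (A (x m) - v)) \<le> \<tau>\<^sup>2 * \<delta>\<^sup>2 \<Longrightarrow>
        \<theta> xdag - \<theta> (x m) - (\<xi>0 - adjoint A (w m)) \<bullet> (xdag - x m) < e"
      by blast
    have "dist (g \<delta>) 0 < e" if \<delta>: "0 < \<delta>" "\<delta> < d" for \<delta>
    proof -
      have "g \<delta> < e" unfolding g_def \<xi>
        by (rule small[OF \<delta>(2) it[OF \<delta>(1)]]) (use stop[OF \<delta>(1)] in \<open>auto simp: r_def\<close>)
      moreover have "0 \<le> c0 * (norm (x\<delta> \<delta> (n\<delta> \<delta>) - xdag))\<^sup>2" using assms(3) by simp
      ultimately show ?thesis using g_ge[of \<delta>] by (simp add: dist_norm)
    qed
    then show "\<forall>\<^sub>F \<delta> in at_right 0. dist (g \<delta>) 0 < e"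
      unfolding eventually_at_right_field using d by blast
  qed
  have "((\<lambda>\<delta>. norm (x\<delta> \<delta> (n\<delta> \<delta>) - xdag)) \<longlongrightarrow> 0) (at_right 0)"
  proof (rule tendsto_sandwich[where f = "\<lambda>_. 0" and h = "\<lambda>\<delta>. sqrt (g \<delta> / c0)"])
    show "((\<lambda>\<delta>. sqrt (g \<delta> / c0)) \<longlongrightarrow> 0) (at_right 0)"
      using tendsto_real_sqrt[OF tendsto_divide_zero[OF g_tendsto, of c0]] by simp
    have "norm (x\<delta> \<delta> (n\<delta> \<delta>) - xdag) \<le> sqrt (g \<delta> / c0)" for \<delta>
      using g_ge[of \<delta>] assms(3) by (intro real_le_rsqrt) (simp add: pos_le_divide_eq mult.commute)
    then show "\<forall>\<^sub>F \<delta> in at_right 0. norm (x\<delta> \<delta> (n\<delta> \<delta>) - xdag) \<le> sqrt (g \<delta> / c0)" by simp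
  qed simp_all
  moreover have "((\<lambda>\<delta>. bregman \<Theta> (\<xi>\<delta> \<delta> (n\<delta> \<delta>)) xdag (x\<delta> \<delta> (n\<delta> \<delta>))) \<longlongrightarrow> 0) (at_right 0)"
    unfolding breg zero_ereal_def using g_tendsto by (rule tendsto_ereal)
  ultimately show ?thesis ..
qed

end
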